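(* In general, the Besselian crossnorm $\alpha_{\mathcal{F},\mathcal{G}}^{Bess}$ is not uniform: there exist Banach spaces $E$ and $F$ with unconditional Schauder bases $\mathcal{F}$ and $\mathcal{G}$, respectively, such that the Besselian crossnorm $\alpha_{\mathcal{F},\mathcal{G}}^{Bess}$, regarded as a reasonable crossnorm on the tensor product of $(E,\|\cdot\|^{Bess}_{E,\mathcal{F}})$ and $(F,\|\cdot\|^{Bess}_{F,\mathcal{G}})$, is not uniform.
   Context: $\mathbb{N}^*=\{1,2,3,\dots\}$; $E^*$ is the topological dual of $E$; $E\otimes F$ is the algebraic tensor product; scalars are real or complex. A sequence of pairs $\mathcal{F}=((a_m,b_m^* ))_{m\in\mathbb{N}^*}\subset E\times E^*$ is an unconditional Schauder basis (USB) for $E$ if every $x\in E$ has a unique expansion in scalar multiples of the $a_m$, this expansion is $x=\sum_m b_m^*(x)a_m$, and the series converges unconditionally for every $x$. Let $\mathcal{G}=((x_n,y_n^* ))_{n\in\mathbb{N}^*}$ be a USB for $F$. The Besselian norm on $E$ is $\|x\|^{Bess}_{E,\mathcal{F}}:=\sup_{\|f^*\|_{E^*}\le1}\sum_{m=1}^\infty|b_m^*(x)f^*(a_m)|$, an equivalent norm on $E$; likewise for $F$ and $\mathcal{G}$. Besselian crossnorm: for a finite sum of elementary tensors put $$Bess\Big(\sum_{r=1}^R x^r\otimes y^r\Big):=\sup_{\|f^*\|_{E^*}\le 1,\ \|g^*\|_{F^*}\le 1}\ \sum_{r=1}^R\sum_{m,n=1}^\infty\left|b_m^*(x^r)\,y_n^*(y^r)\,f^*(a_m)\,g^*(x_n)\right|,$$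 and for $u\in E\otimes F$ put $\alpha_{\mathcal{F},\mathcal{G}}^{Bess}(u):=\inf\{Bess(\sum_{r=1}^R x^r\otimes y^r): u=\sum_{r=1}^R x^r\otimes y^r\}$, the infimum over all finite representations of $u$. It is a reasonable crossnorm on the tensor product of $(E,\|\cdot\|^{Bess}_{E,\mathcal{F}})$ and $(F,\|\cdot\|^{Bess}_{F,\mathcal{G}})$. A reasonable crossnorm $\alpha$ on $X\otimes Y$ ($X,Y$ Banach spaces) is uniform if for all bounded linear operators $S\in L(X)$, $T\in L(Y)$ and all $u\in X\otimes Y$ one has $\alpha((S\otimes T)(u))\le\|S\|_{L(X)}\|T\|_{L(Y)}\,\alpha(u)$, where $(S\otimes T)(\sum_r x^r\otimes y^r)=\sum_r S(x^r)\otimes T(y^r)$ and $L(X)$ carries the operator norm. *)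

theory Defs
  imports Complex_Main
    "HOL-Library.Function_Algebras"
    "HOL-Library.Extended_Nonnegative_Real"
begin

section \<open>Normed spaces with explicit carrier\<close>

text \<open>
  The statement quantifies existentially over Banach spaces, so a space is a value and not a
  type: a linear subspace of an ambient vector space, with a norm that is only relevant on it.
  A space with a Schauder basis embeds linearly into the scalar sequences by its coefficients, so
  \<open>nat \<Rightarrow> 'k\<close> is a large enough ambient space up to isometric isomorphism.
  The scalar type \<open>'k\<close> is meant to be \<^typ>\<open>real\<close> or \<^typ>\<open>complex\<close>.
\<close>

record ('k, 'a) nspace =
  scl :: "'k \<Rightarrow> 'a \<Rightarrow> 'a"
  carr :: "'a set"
  nrm :: "'a \<Rightarrow> real"

definition normed_space :: "('k::real_normed_field, 'a::ab_group_add) nspace \<Rightarrow> bool" where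
  "normed_space X \<longleftrightarrow>
     vector_space (scl X) \<and> module.subspace (scl X) (carr X) \<and>
     (\<forall>x\<in>carr X. 0 \<le> nrm X x) \<and>
     (\<forall>x\<in>carr X. nrm X x = 0 \<longleftrightarrow> x = 0) \<and>
     (\<forall>c. \<forall>x\<in>carr X. nrm X (scl X c x) = norm c * nrm X x) \<and>
     (\<forall>x\<in>carr X. \<forall>y\<in>carr X. nrm X (x + y) \<le> nrm X x + nrm X y)"

definition converges_to :: "('k, 'a::ab_group_add) nspace \<Rightarrow> (nat \<Rightarrow> 'a) \<Rightarrow> 'a \<Rightarrow> bool" where
  "converges_to X s l \<longleftrightarrow> l \<in> carr X \<and> (\<lambda>n. nrm X (s n - l)) \<longlonglongrightarrow> 0"

definition cauchy_seq :: "('k, 'a::ab_group_add) nspace \<Rightarrow> (nat \<Rightarrow> 'a) \<Rightarrow> bool" where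
  "cauchy_seq X s \<longleftrightarrow> (\<forall>e>0. \<exists>M. \<forall>m\<ge>M. \<forall>n\<ge>M. nrm X (s m - s n) < e)"

definition banach_space :: "('k::real_normed_field, 'a::ab_group_add) nspace \<Rightarrow> bool" where
  "banach_space X \<longleftrightarrow> normed_space X \<and>
     (\<forall>s. range s \<subseteq> carr X \<and> cauchy_seq X s \<longrightarrow> (\<exists>l. converges_to X s l))"

definition scalar_space :: "('k::real_normed_field, 'k) nspace" where
  "scalar_space = \<lparr>scl = (*), carr = UNIV, nrm = norm\<rparr>"

text \<open>Pointwise scalar multiplication on a space of scalar-valued functions.\<close>

definition fun_scl :: "'k::real_normed_field \<Rightarrow> ('i \<Rightarrow> 'k) \<Rightarrow> 'i \<Rightarrow> 'k" where
  "fun_scl c f = (\<lambda>i. c * f i)"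

section \<open>Bounded operators and functionals\<close>

text \<open>Only the values on the carrier of the domain matter.\<close>

definition bounded_ops ::
  "('k, 'a::ab_group_add) nspace \<Rightarrow> ('k, 'b::ab_group_add) nspace \<Rightarrow> ('a \<Rightarrow> 'b) set" where
  "bounded_ops X Y = {S.
     (\<forall>x\<in>carr X. S x \<in> carr Y) \<and>
     (\<forall>x\<in>carr X. \<forall>y\<in>carr X. S (x + y) = S x + S y) \<and>
     (\<forall>c. \<forall>x\<in>carr X. S (scl X c x) = scl Y c (S x)) \<and>
     (\<exists>C. \<forall>x\<in>carr X. nrm Y (S x) \<le> C * nrm X x)}"

definition op_norm :: "('k, 'a) nspace \<Rightarrow> ('k, 'b) nspace \<Rightarrow> ('a \<Rightarrow> 'b) \<Rightarrow> real" where
  "op_norm X Y S = (SUP x\<in>{x \<in> carr X. nrm X x \<le> 1}. nrm Y (S x))"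

definition dual :: "('k::real_normed_field, 'a::ab_group_add) nspace \<Rightarrow> ('a \<Rightarrow> 'k) set" where
  "dual X = bounded_ops X scalar_space"

definition dual_norm :: "('k::real_normed_field, 'a) nspace \<Rightarrow> ('a \<Rightarrow> 'k) \<Rightarrow> real" where
  "dual_norm X f = op_norm X scalar_space f"

definition dual_ball :: "('k::real_normed_field, 'a::ab_group_add) nspace \<Rightarrow> ('a \<Rightarrow> 'k) set" where
  "dual_ball X = {f \<in> dual X. dual_norm X f \<le> 1}"

section \<open>Unconditional Schauder bases and the Besselian norm\<close>

text \<open>A basis is a sequence of pairs (vector, coefficient functional), indexed from \<open>0\<close>.\<close>

type_synonym ('k, 'a) pairs = "nat \<Rightarrow> 'a \<times> ('a \<Rightarrow> 'k)"

definition usb :: "('k::real_normed_field, 'a::ab_group_add) nspace \<Rightarrow> ('k, 'a) pairs \<Rightarrow> bool" where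
  "usb X \<F> \<longleftrightarrow>
     (\<forall>m. fst (\<F> m) \<in> carr X \<and> snd (\<F> m) \<in> dual X) \<and>
     (\<forall>x\<in>carr X.
        converges_to X (\<lambda>n. \<Sum>m<n. scl X (snd (\<F> m) x) (fst (\<F> m))) x \<and>
        (\<forall>c. converges_to X (\<lambda>n. \<Sum>m<n. scl X (c m) (fst (\<F> m))) x \<longrightarrow>
             (\<forall>m. c m = snd (\<F> m) x)) \<and>
        (\<forall>\<pi>. bij \<pi> \<longrightarrow>
             (\<exists>l. converges_to X (\<lambda>n. \<Sum>m<n. scl X (snd (\<F> (\<pi> m)) x) (fst (\<F> (\<pi> m)))) l)))"

text \<open>
  Suprema of series of nonnegative terms are taken in \<^typ>\<open>ennreal\<close>, so that no convergence has
  to be presupposed; for an unconditional Schauder basis of a Banach space they are finite.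
\<close>

definition bess_norm ::
  "('k::real_normed_field, 'a::ab_group_add) nspace \<Rightarrow> ('k, 'a) pairs \<Rightarrow> 'a \<Rightarrow> real" where
  "bess_norm X \<F> x =
     enn2real (SUP f\<in>dual_ball X. \<Sum>m. ennreal (norm (snd (\<F> m) x * f (fst (\<F> m)))))"

definition bess_space ::
  "('k::real_normed_field, 'a::ab_group_add) nspace \<Rightarrow> ('k, 'a) pairs \<Rightarrow> ('k, 'a) nspace" where
  "bess_space X \<F> = X\<lparr>nrm := bess_norm X \<F>\<rparr>"

section \<open>The algebraic tensor product\<close>

definition bilinear_forms ::
  "('k::real_normed_field, 'a::ab_group_add) nspace \<Rightarrow> ('k, 'b::ab_group_add) nspace \<Rightarrow>
   ('a \<Rightarrow> 'b \<Rightarrow> 'k) set" where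
  "bilinear_forms X Y = {B.
     (\<forall>x\<in>carr X. \<forall>x'\<in>carr X. \<forall>y\<in>carr Y. B (x + x') y = B x y + B x' y) \<and>
     (\<forall>c. \<forall>x\<in>carr X. \<forall>y\<in>carr Y. B (scl X c x) y = c * B x y) \<and>
     (\<forall>x\<in>carr X. \<forall>y\<in>carr Y. \<forall>y'\<in>carr Y. B x (y + y') = B x y + B x y') \<and>
     (\<forall>c. \<forall>x\<in>carr X. \<forall>y\<in>carr Y. B x (scl Y c y) = c * B x y)}"

text \<open>
  As usual for tensor products of Banach spaces, \<open>x \<otimes> y\<close> is the functional \<open>B \<mapsto> B x y\<close> on
  the space of all bilinear forms on \<open>X \<times> Y\<close>, and \<open>X \<otimes> Y\<close> is the linear span of these functionals.
  (The value \<open>0\<close> off the bilinear forms only makes equality of functionals the right one.)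
  A list of pairs \<open>[(x\<^sup>1, y\<^sup>1), \<dots>, (x\<^sup>R, y\<^sup>R)]\<close> represents the finite sum of the \<open>x\<^sup>r \<otimes> y\<^sup>r\<close>;
  as scalars can be absorbed into \<open>x\<^sup>r\<close>, such sums exhaust the span.
\<close>

type_synonym ('k, 'a, 'b) tensor = "('a \<Rightarrow> 'b \<Rightarrow> 'k) \<Rightarrow> 'k"

definition tensor_of ::
  "('k::real_normed_field, 'a::ab_group_add) nspace \<Rightarrow> ('k, 'b::ab_group_add) nspace \<Rightarrow>
   ('a \<times> 'b) list \<Rightarrow> ('k, 'a, 'b) tensor" where
  "tensor_of X Y zs = (\<lambda>B. if B \<in> bilinear_forms X Y then \<Sum>(x, y)\<leftarrow>zs. B x y else 0)"

definition tensor_product ::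
  "('k::real_normed_field, 'a::ab_group_add) nspace \<Rightarrow> ('k, 'b::ab_group_add) nspace \<Rightarrow>
   ('k, 'a, 'b) tensor set" where
  "tensor_product X Y = {tensor_of X Y zs | zs. set zs \<subseteq> carr X \<times> carr Y}"

text \<open>\<open>S \<otimes> T\<close>, for linear operators \<open>S\<close> on \<open>X\<close> and \<open>T\<close> on \<open>Y\<close>, as precomposition of
  bilinear forms; see \<open>tensor_map_tensor_of\<close>.\<close>

definition tensor_map ::
  "('k::real_normed_field, 'a::ab_group_add) nspace \<Rightarrow> ('k, 'b::ab_group_add) nspace \<Rightarrow>
   ('a \<Rightarrow> 'a) \<Rightarrow> ('b \<Rightarrow> 'b) \<Rightarrow> ('k, 'a, 'b) tensor \<Rightarrow> ('k, 'a, 'b) tensor" where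
  "tensor_map X Y S T u =
     (\<lambda>B. if B \<in> bilinear_forms X Y then u (\<lambda>x y. B (S x) (T y)) else 0)"

lemma tensor_map_tensor_of:
  assumes "S \<in> bounded_ops X X" and "T \<in> bounded_ops Y Y"
  shows "tensor_map X Y S T (tensor_of X Y zs) = tensor_of X Y (map (map_prod S T) zs)"
proof
  fix B
  have "(\<lambda>x y. B (S x) (T y)) \<in> bilinear_forms X Y" if "B \<in> bilinear_forms X Y"
    using that assms by (simp add: bilinear_forms_def bounded_ops_def)
  then show "tensor_map X Y S T (tensor_of X Y zs) B =
             tensor_of X Y (map (map_prod S T) zs) B"
    by (auto simp: tensor_map_def tensor_of_def o_def map_prod_def case_prod_unfold)
qed

section \<open>Crossnorms\<close>

text \<open>The functional \<open>\<phi> \<otimes> \<psi>\<close> on \<open>X \<otimes> Y\<close> is evaluation at the bilinear form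
  \<open>(x, y) \<mapsto> \<phi> x * \<psi> y\<close>.\<close>

definition reasonable_crossnorm ::
  "('k::real_normed_field, 'a::ab_group_add) nspace \<Rightarrow> ('k, 'b::ab_group_add) nspace \<Rightarrow>
   (('k, 'a, 'b) tensor \<Rightarrow> real) \<Rightarrow> bool" where
  "reasonable_crossnorm X Y \<alpha> \<longleftrightarrow>
     banach_space X \<and> banach_space Y \<and>
     normed_space \<lparr>scl = fun_scl, carr = tensor_product X Y, nrm = \<alpha>\<rparr> \<and>
     (\<forall>x\<in>carr X. \<forall>y\<in>carr Y. \<alpha> (tensor_of X Y [(x, y)]) \<le> nrm X x * nrm Y y) \<and>
     (\<forall>\<phi>\<in>dual X. \<forall>\<psi>\<in>dual Y. \<forall>u\<in>tensor_product X Y.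
        norm (u (\<lambda>x y. \<phi> x * \<psi> y)) \<le> dual_norm X \<phi> * dual_norm Y \<psi> * \<alpha> u)"

definition uniform_crossnorm ::
  "('k::real_normed_field, 'a::ab_group_add) nspace \<Rightarrow> ('k, 'b::ab_group_add) nspace \<Rightarrow>
   (('k, 'a, 'b) tensor \<Rightarrow> real) \<Rightarrow> bool" where
  "uniform_crossnorm X Y \<alpha> \<longleftrightarrow>
     (\<forall>S\<in>bounded_ops X X. \<forall>T\<in>bounded_ops Y Y. \<forall>u\<in>tensor_product X Y.
        \<alpha> (tensor_map X Y S T u) \<le> op_norm X X S * op_norm Y Y T * \<alpha> u)"

definition bess_sum ::
  "('k::real_normed_field, 'a::ab_group_add) nspace \<Rightarrow> ('k, 'a) pairs \<Rightarrow>
   ('k, 'b::ab_group_add) nspace \<Rightarrow> ('k, 'b) pairs \<Rightarrow> ('a \<times> 'b) list \<Rightarrow> ennreal" where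
  "bess_sum E \<F> F \<G> zs =
     (SUP (f, g)\<in>dual_ball E \<times> dual_ball F.
        \<Sum>(x, y)\<leftarrow>zs. \<Sum>m. \<Sum>n.
          ennreal (norm (snd (\<F> m) x * snd (\<G> n) y * f (fst (\<F> m)) * g (fst (\<G> n)))))"

definition bess_crossnorm ::
  "('k::real_normed_field, 'a::ab_group_add) nspace \<Rightarrow> ('k, 'a) pairs \<Rightarrow>
   ('k, 'b::ab_group_add) nspace \<Rightarrow> ('k, 'b) pairs \<Rightarrow> ('k, 'a, 'b) tensor \<Rightarrow> real" where
  "bess_crossnorm E \<F> F \<G> u =
     enn2real (INF zs\<in>{zs. set zs \<subseteq> carr E \<times> carr F \<and> tensor_of E F zs = u}.
       bess_sum E \<F> F \<G> zs)"

end

theory Submission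
  imports Defs "HOL-Analysis.Inner_Product"
begin

text \<open>
  The counterexample is \<open>E = F\<close>, the null sequences with the norm
  \<open>N x = max (sup\<^sub>m |x\<^sub>m|) (2/3 (|x\<^sub>0| + |x\<^sub>1|))\<close>, and the unit vector basis \<open>e\<^sub>m\<close>. The norm \<open>N\<close> is equivalent
  to the supremum norm, so the space is a Banach space and the basis is unconditional. It depends
  only on the moduli of the entries, hence a functional in the dual ball satisfies
  \<open>\<Sum>\<^sub>m |x\<^sub>m f(e\<^sub>m)| \<le> N x\<close>, and the Besselian norm is \<open>N\<close> itself (\<open>bess_space_oct\<close>).

  Write \<open>|f|(x) = \<Sum>\<^sub>m |x\<^sub>m f(e\<^sub>m)|\<close> (\<open>abs_pairing\<close>). The double series in the Besselian crossnorm
  factorises, so that \<open>\<alpha>(u)\<close> is the infimum over the representations of \<open>u\<close> of the supremum over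
  \<open>f, g\<close> in the dual ball of \<open>\<Sum>\<^sub>r |f|(x\<^sup>r) |g|(y\<^sup>r)\<close>. That \<open>\<alpha>\<close> is a reasonable crossnorm follows from this
  formula. Only definiteness needs an extra argument: \<open>\<alpha>(u) = 0\<close> forces all entries \<open>u\<^sub>m\<^sub>n\<close> of \<open>u\<close>,
  its values at the products of coordinate functionals, to vanish, and then \<open>u = 0\<close> by elimination
  of one elementary tensor after the other (\<open>tensor_of_eq_zero\<close>).

  Uniformity fails because \<open>\<alpha>\<close> sees only moduli. Let \<open>u = e\<^sub>0 \<otimes> e\<^sub>0 + e\<^sub>1 \<otimes> e\<^sub>1\<close> and let \<open>S\<close> send \<open>x\<close> to
  \<open>2/3 (x\<^sub>0 + x\<^sub>1, x\<^sub>0 - x\<^sub>1, 0, 0, \<dots>)\<close>. By the parallelogram law \<open>S\<close> has norm at most \<open>1\<close>, over the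
  complex numbers as well as over the reals (\<open>op_norm_hadamard01_le\<close>), and \<open>\<alpha>(u) \<le> 1\<close>
  (\<open>rep_sum_diag01_le\<close>). On the other hand, pairing with \<open>f = g = 2/3 (e\<^sub>0\<^sup>* + e\<^sub>1\<^sup>*)\<close> bounds \<open>\<alpha>(v)\<close> from
  below by \<open>4/9\<close> times the sum of the moduli of the entries \<open>v\<^sub>m\<^sub>n\<close> with \<open>m, n < 2\<close>
  (\<open>entries_le_oct_cross\<close>). For \<open>v = (S \<otimes> id)(u)\<close> these are all \<open>2/3\<close>, so \<open>\<alpha>(v) \<ge> 32/27 > 1\<close>.

  All of this works for every scalar field that is complete and whose norm satisfies the
  parallelogram law, so the real and the complex case are instances of one result.
\<close>

section \<open>Operators between normed spaces with explicit carrier\<close>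

lemma vector_space_fun_scl: "vector_space (fun_scl :: 'k::real_normed_field \<Rightarrow> ('i \<Rightarrow> 'k) \<Rightarrow> 'i \<Rightarrow> 'k)"
  by unfold_locales (auto simp: fun_scl_def fun_eq_iff algebra_simps)

lemma module_fun_scl: "module (fun_scl :: 'k::real_normed_field \<Rightarrow> ('i \<Rightarrow> 'k) \<Rightarrow> 'i \<Rightarrow> 'k)"
  using vector_space_fun_scl by (simp add: module_iff_vector_space)

lemma normed_space_zero_in_carr:
  assumes "normed_space X"
  shows "0 \<in> carr X" and "nrm X 0 = 0"
proof -
  have m: "module (scl X)"
    using assms by (simp add: normed_space_def module_iff_vector_space)
  show z: "0 \<in> carr X"
    using assms module.subspace_0[OF m] by (simp add: normed_space_def)
  show "nrm X 0 = 0"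
    using assms z by (simp add: normed_space_def)
qed

lemma normed_space_scl_in_carr:
  assumes "normed_space X" "x \<in> carr X"
  shows "scl X c x \<in> carr X"
proof -
  have m: "module (scl X)"
    using assms by (simp add: normed_space_def module_iff_vector_space)
  show ?thesis
    using assms module.subspace_scale[OF m] by (simp add: normed_space_def)
qed

lemma bdd_above_op_norm:
  assumes X: "normed_space X" and S: "S \<in> bounded_ops X Y"
  shows "bdd_above ((\<lambda>x. nrm Y (S x)) ` {x \<in> carr X. nrm X x \<le> 1})"
proof -
  obtain C where C: "\<And>x. x \<in> carr X \<Longrightarrow> nrm Y (S x) \<le> C * nrm X x"
    using S unfolding bounded_ops_def by blast
  have "nrm Y (S x) \<le> max 0 C" if x: "x \<in> carr X" "nrm X x \<le> 1" for x
  proof -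
    have n: "0 \<le> nrm X x"
      using X x by (simp add: normed_space_def)
    have "C * nrm X x \<le> max 0 C * nrm X x"
      using n by (intro mult_right_mono) auto
    also have "\<dots> \<le> max 0 C * 1"
      using x by (intro mult_left_mono) auto
    finally show ?thesis using C[OF x(1)] by simp
  qed
  then show ?thesis by (auto intro!: bdd_aboveI)
qed

lemma op_norm_nonneg:
  assumes X: "normed_space X" and Y: "normed_space Y" and S: "S \<in> bounded_ops X Y"
  shows "0 \<le> op_norm X Y S"
proof -
  have "S 0 \<in> carr Y"
    using S normed_space_zero_in_carr(1)[OF X] by (simp add: bounded_ops_def)
  then have "0 \<le> nrm Y (S 0)"
    using Y by (simp add: normed_space_def)
  also have "\<dots> \<le> op_norm X Y S"
    unfolding op_norm_def using normed_space_zero_in_carr[OF X]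
    by (intro cSUP_upper bdd_above_op_norm[OF X S]) auto
  finally show ?thesis .
qed

lemma op_norm_le:
  assumes X: "normed_space X" and "\<And>x. x \<in> carr X \<Longrightarrow> nrm X x \<le> 1 \<Longrightarrow> nrm Y (S x) \<le> B"
  shows "op_norm X Y S \<le> B"
  unfolding op_norm_def using normed_space_zero_in_carr[OF X] assms(2)
  by (intro cSUP_least) (auto intro!: exI[of _ 0])

lemma nrm_le_op_norm:
  fixes X :: "('k::real_normed_field, 'a::ab_group_add) nspace"
  assumes X: "normed_space X" and Y: "normed_space Y" and S: "S \<in> bounded_ops X Y"
    and x: "x \<in> carr X"
  shows "nrm Y (S x) \<le> op_norm X Y S * nrm X x"
proof (cases "nrm X x = 0")
  case True
  then show ?thesis using S x by (auto simp: bounded_ops_def)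
next
  case False
  let ?t = "nrm X x"
  let ?c = "inverse (of_real ?t) :: 'k"
  have t: "?t > 0"
    using X x False by (auto simp: normed_space_def less_le)
  have c: "norm ?c = inverse ?t"
    using t by (simp add: norm_inverse)
  have xc: "scl X ?c x \<in> carr X"
    using normed_space_scl_in_carr[OF X x] .
  have n1: "nrm X (scl X ?c x) = inverse ?t * ?t"
    using X x c by (metis normed_space_def)
  have "nrm Y (S (scl X ?c x)) \<le> op_norm X Y S"
    unfolding op_norm_def using xc n1 t
    by (intro cSUP_upper bdd_above_op_norm[OF X S]) auto
  moreover have "nrm Y (S (scl X ?c x)) = inverse ?t * nrm Y (S x)"
  proof -
    have "S (scl X ?c x) = scl Y ?c (S x)" "S x \<in> carr Y"
      using S x by (auto simp: bounded_ops_def)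
    then show ?thesis using Y c by (metis normed_space_def)
  qed
  ultimately have "inverse ?t * nrm Y (S x) \<le> op_norm X Y S" by simp
  then have "?t * (inverse ?t * nrm Y (S x)) \<le> ?t * op_norm X Y S"
    using t by (intro mult_left_mono) auto
  moreover have "?t * (inverse ?t * nrm Y (S x)) = nrm Y (S x)"
    using t by simp
  ultimately show ?thesis by (metis mult.commute)
qed

lemma normed_space_scalar: "normed_space (scalar_space :: ('k::real_normed_field, 'k) nspace)"
proof -
  have v: "vector_space ((*) :: 'k \<Rightarrow> 'k \<Rightarrow> 'k)"
    by unfold_locales (auto simp: algebra_simps)
  then have m: "module ((*) :: 'k \<Rightarrow> 'k \<Rightarrow> 'k)"
    by (simp add: module_iff_vector_space)
  show ?thesis
    using v module.subspace_UNIV[OF m]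
    by (auto simp: normed_space_def scalar_space_def norm_mult norm_triangle_ineq)
qed

lemma norm_dual_le:
  fixes X :: "('k::real_normed_field, 'a::ab_group_add) nspace"
  assumes "normed_space X" "f \<in> dual X" "x \<in> carr X"
  shows "norm (f x) \<le> dual_norm X f * nrm X x"
  using nrm_le_op_norm[OF assms(1) normed_space_scalar, of f x] assms
  by (simp add: dual_def dual_norm_def scalar_space_def)

lemma dual_norm_nonneg:
  fixes X :: "('k::real_normed_field, 'a::ab_group_add) nspace"
  assumes "normed_space X" "f \<in> dual X"
  shows "0 \<le> dual_norm X f"
  using op_norm_nonneg[OF assms(1) normed_space_scalar] assms(2)
  by (simp add: dual_def dual_norm_def)

lemma norm_dual_ball_le:
  fixes X :: "('k::real_normed_field, 'a::ab_group_add) nspace"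
  assumes "normed_space X" "f \<in> dual_ball X" "x \<in> carr X"
  shows "norm (f x) \<le> nrm X x"
proof -
  have f: "f \<in> dual X" "dual_norm X f \<le> 1"
    using assms by (auto simp: dual_ball_def)
  have "0 \<le> nrm X x"
    using assms by (simp add: normed_space_def)
  then have "dual_norm X f * nrm X x \<le> 1 * nrm X x"
    using f by (intro mult_right_mono)
  then show ?thesis using norm_dual_le[OF assms(1) f(1) assms(3)] by simp
qed

lemma dual_ballI:
  fixes X :: "('k::real_normed_field, 'a::ab_group_add) nspace"
  assumes X: "normed_space X"
    and "\<And>x y. x \<in> carr X \<Longrightarrow> y \<in> carr X \<Longrightarrow> f (x + y) = f x + f y"
    and "\<And>c x. x \<in> carr X \<Longrightarrow> f (scl X c x) = c * f x"
    and "\<And>x. x \<in> carr X \<Longrightarrow> norm (f x) \<le> nrm X x"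
  shows "f \<in> dual_ball X"
proof -
  have "f \<in> dual X"
    using assms by (auto simp: dual_def bounded_ops_def scalar_space_def intro!: exI[of _ 1])
  moreover have "dual_norm X f \<le> 1"
    unfolding dual_norm_def using assms(4)
    by (intro op_norm_le[OF X]) (fastforce simp: scalar_space_def)
  ultimately show ?thesis by (simp add: dual_ball_def)
qed

section \<open>A renorming of the null sequences\<close>

text \<open>The carrier of the space \<open>c\<^sub>0\<close>.\<close>

definition null_seqs :: "(nat \<Rightarrow> 'k::real_normed_field) set" where
  "null_seqs = {x. x \<longlonglongrightarrow> 0}"

text \<open>
  The norm \<open>N\<close>, with values in \<^typ>\<open>ennreal\<close> so that it makes sense for unbounded sequences
  too. Over the reals its unit ball meets the plane of the first two coordinates in an octagon.
\<close>

definition oct_norm :: "(nat \<Rightarrow> 'k::real_normed_field) \<Rightarrow> ennreal" where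
  "oct_norm x = max (SUP m. ennreal (norm (x m))) (ennreal (2/3 * (norm (x 0) + norm (x 1))))"

text \<open>
  The norm of the space is defined off the carrier by the same formula; thanks to this, forming
  the Besselian space later gives back literally the same record.
\<close>

definition oct_space :: "('k::real_normed_field, nat \<Rightarrow> 'k) nspace" where
  "oct_space = \<lparr>scl = fun_scl, carr = null_seqs, nrm = \<lambda>x. enn2real (oct_norm x)\<rparr>"

text \<open>The unit vectors, and the basis that they form together with the coordinate functionals.\<close>

definition unit_vec :: "nat \<Rightarrow> nat \<Rightarrow> 'k::real_normed_field" where
  "unit_vec m = (\<lambda>i. if i = m then 1 else 0)"

definition unit_basis :: "('k::real_normed_field, nat \<Rightarrow> 'k) pairs" where
  "unit_basis m = (unit_vec m, \<lambda>x. x m)"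

lemma oct_space_simps [simp]:
  "scl oct_space = fun_scl" "carr oct_space = null_seqs"
  "nrm oct_space x = enn2real (oct_norm x)"
  by (simp_all add: oct_space_def)

lemma unit_basis_simps [simp]:
  "fst (unit_basis m) = unit_vec m" "snd (unit_basis m) = (\<lambda>x. x m)"
  by (simp_all add: unit_basis_def)

lemma oct_norm_le_iff:
  assumes "0 \<le> B"
  shows "oct_norm x \<le> ennreal B \<longleftrightarrow>
    (\<forall>m. norm (x m) \<le> B) \<and> 2/3 * (norm (x 0) + norm (x 1)) \<le> B"
  using assms by (simp add: oct_norm_def SUP_le_iff del: ennreal_plus)

lemma oct_norm_mono:
  assumes "\<And>m. norm (x m) \<le> norm (y m)"
  shows "oct_norm x \<le> oct_norm y"
proof -
  have "norm (x 0) + norm (x 1) \<le> norm (y 0) + norm (y 1)"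
    using assms by (intro add_mono)
  then show ?thesis
    unfolding oct_norm_def using assms
    by (intro max.mono SUP_mono ennreal_leI) (auto intro: ennreal_leI)
qed

lemma null_seqs_intros:
  "(0 :: nat \<Rightarrow> 'k::real_normed_field) \<in> null_seqs"
  "x \<in> null_seqs \<Longrightarrow> y \<in> null_seqs \<Longrightarrow> x + y \<in> null_seqs"
  "x \<in> null_seqs \<Longrightarrow> y \<in> null_seqs \<Longrightarrow> x - y \<in> null_seqs"
  "x \<in> null_seqs \<Longrightarrow> fun_scl c x \<in> null_seqs"
proof -
  show "(0 :: nat \<Rightarrow> 'k::real_normed_field) \<in> null_seqs"
    by (simp add: null_seqs_def zero_fun_def)
  show "x \<in> null_seqs \<Longrightarrow> y \<in> null_seqs \<Longrightarrow> x + y \<in> null_seqs"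
    using tendsto_add[of x 0 sequentially y 0] by (simp add: null_seqs_def plus_fun_def)
  show "x \<in> null_seqs \<Longrightarrow> y \<in> null_seqs \<Longrightarrow> x - y \<in> null_seqs"
    using tendsto_diff[of x 0 sequentially y 0] by (simp add: null_seqs_def fun_diff_def)
  show "x \<in> null_seqs \<Longrightarrow> fun_scl c x \<in> null_seqs"
    using tendsto_mult_left[of x 0 sequentially c] by (simp add: null_seqs_def fun_scl_def)
qed

lemma eventually_zero_in_null_seqs:
  assumes "\<And>i. i \<ge> n \<Longrightarrow> x i = 0"
  shows "x \<in> null_seqs"
  unfolding null_seqs_def mem_Collect_eq
  using assms by (intro tendsto_eventually eventually_sequentiallyI[of n])

lemma prefix_in_null_seqs: "(\<lambda>i. if i < n then c i else 0) \<in> null_seqs"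
  by (rule eventually_zero_in_null_seqs[of n]) simp

lemma unit_vec_in_null_seqs: "unit_vec m \<in> null_seqs"
  by (rule eventually_zero_in_null_seqs[of "Suc m"]) (simp add: unit_vec_def)

lemma oct_norm_finite:
  assumes "x \<in> null_seqs"
  shows "oct_norm x = ennreal (enn2real (oct_norm x))"
proof -
  have "Bseq x"
    using assms by (auto simp: null_seqs_def intro: convergent_imp_Bseq convergentI)
  then obtain K where K: "K > 0" "\<And>m. norm (x m) \<le> K"
    by (auto elim: BseqE)
  have "oct_norm x \<le> ennreal (4/3 * K)"
  proof (subst oct_norm_le_iff, goal_cases)
    case 2
    have "norm (x m) \<le> 4/3 * K" for m
      using K(1) K(2)[of m] by linarith
    moreover have "2/3 * (norm (x 0) + norm (x 1)) \<le> 4/3 * K"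
      using add_mono[OF K(2)[of 0] K(2)[of 1]] by simp
    ultimately show ?case by blast
  qed (use K(1) in simp)
  then have "oct_norm x < top"
    using le_less_trans by fastforce
  then show ?thesis by simp
qed

lemma nrm_oct_le_iff:
  assumes "x \<in> null_seqs" "0 \<le> B"
  shows "enn2real (oct_norm x) \<le> B \<longleftrightarrow>
    (\<forall>m. norm (x m) \<le> B) \<and> 2/3 * (norm (x 0) + norm (x 1)) \<le> B"
  using oct_norm_le_iff[OF assms(2), of x] oct_norm_finite[OF assms(1)] assms(2)
  by (metis ennreal_le_iff)

lemma nrm_oct_bounds:
  assumes "x \<in> null_seqs"
  shows "norm (x m) \<le> enn2real (oct_norm x)"
    and "2/3 * (norm (x 0) + norm (x 1)) \<le> enn2real (oct_norm x)"
  using nrm_oct_le_iff[OF assms, of "enn2real (oct_norm x)"] by auto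

lemma nrm_oct_le_of_sup:
  assumes "x \<in> null_seqs" "\<And>m. norm (x m) \<le> B"
  shows "enn2real (oct_norm x) \<le> 4/3 * B"
proof -
  have "0 \<le> B" using assms(2)[of 0] norm_ge_zero order_trans by blast
  moreover have "norm (x m) \<le> 4/3 * B" for m
    using assms(2)[of m] \<open>0 \<le> B\<close> by linarith
  moreover have "2/3 * (norm (x 0) + norm (x 1)) \<le> 4/3 * B"
    using add_mono[OF assms(2)[of 0] assms(2)[of 1]] by simp
  ultimately show ?thesis
    using nrm_oct_le_iff[OF assms(1), of "4/3 * B"] \<open>0 \<le> B\<close> by simp
qed

lemma nrm_oct_scl_le:
  assumes "x \<in> null_seqs"
  shows "enn2real (oct_norm (fun_scl c x)) \<le> norm c * enn2real (oct_norm x)"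
proof -
  have "norm c * (2/3 * (norm (x 0) + norm (x 1))) \<le> norm c * enn2real (oct_norm x)"
    by (intro mult_left_mono nrm_oct_bounds assms) auto
  then show ?thesis
    using nrm_oct_bounds(1)[OF assms]
    by (subst nrm_oct_le_iff[OF null_seqs_intros(4)[OF assms]])
      (auto simp: fun_scl_def norm_mult algebra_simps intro: mult_left_mono)
qed

lemma normed_space_oct: "normed_space (oct_space :: ('k::real_normed_field, nat \<Rightarrow> 'k) nspace)"
  unfolding normed_space_def oct_space_simps
proof (intro conjI ballI allI)
  show "vector_space (fun_scl :: 'k \<Rightarrow> (nat \<Rightarrow> 'k) \<Rightarrow> nat \<Rightarrow> 'k)"
    by (rule vector_space_fun_scl)
  show "module.subspace fun_scl (null_seqs :: (nat \<Rightarrow> 'k) set)"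
    by (auto simp: module.subspace_def[OF module_fun_scl] intro: null_seqs_intros)
next
  fix x y :: "nat \<Rightarrow> 'k" assume xy: "x \<in> null_seqs" "y \<in> null_seqs"
  show "enn2real (oct_norm (x + y)) \<le> enn2real (oct_norm x) + enn2real (oct_norm y)"
  proof (subst nrm_oct_le_iff, goal_cases)
    case 3
    show ?case
    proof (intro conjI allI)
      fix m show "norm ((x + y) m) \<le> enn2real (oct_norm x) + enn2real (oct_norm y)"
        using nrm_oct_bounds(1)[OF xy(1), of m] nrm_oct_bounds(1)[OF xy(2), of m]
          norm_triangle_ineq[of "x m" "y m"] by simp
      show "2/3 * (norm ((x + y) 0) + norm ((x + y) 1))
          \<le> enn2real (oct_norm x) + enn2real (oct_norm y)"
        using nrm_oct_bounds(2)[OF xy(1)] nrm_oct_bounds(2)[OF xy(2)]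
          norm_triangle_ineq[of "x 0" "y 0"] norm_triangle_ineq[of "x 1" "y 1"]
        by (simp add: algebra_simps)
    qed
  qed (use xy null_seqs_intros in auto)
next
  fix x :: "nat \<Rightarrow> 'k" assume x: "x \<in> null_seqs"
  show "(enn2real (oct_norm x) = 0) = (x = 0)"
  proof
    assume "enn2real (oct_norm x) = 0"
    then show "x = 0" using nrm_oct_bounds(1)[OF x] by (auto simp: fun_eq_iff)
  next
    assume "x = 0"
    then have "enn2real (oct_norm x) \<le> 0"
      by (subst nrm_oct_le_iff[OF x]) auto
    then show "enn2real (oct_norm x) = 0"
      using enn2real_nonneg antisym by blast
  qed
next
  fix c :: 'k and x :: "nat \<Rightarrow> 'k" assume x: "x \<in> null_seqs"
  show "enn2real (oct_norm (fun_scl c x)) = norm c * enn2real (oct_norm x)"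
  proof (cases "c = 0")
    case True
    then show ?thesis using nrm_oct_scl_le[OF x, of c] by (simp add: antisym)
  next
    case False
    have "fun_scl (inverse c) (fun_scl c x) = x"
      using False by (simp add: fun_scl_def fun_eq_iff)
    then have "enn2real (oct_norm x) \<le> norm (inverse c) * enn2real (oct_norm (fun_scl c x))"
      using nrm_oct_scl_le[OF null_seqs_intros(4)[OF x], of "inverse c" c] by simp
    then have "enn2real (oct_norm x) \<le> enn2real (oct_norm (fun_scl c x)) / norm c"
      by (simp add: norm_inverse divide_inverse mult.commute)
    then have "norm c * enn2real (oct_norm x) \<le> enn2real (oct_norm (fun_scl c x))"
      using False by (subst (asm) pos_le_divide_eq) (auto simp: mult.commute)
    then show ?thesis using nrm_oct_scl_le[OF x, of c] by simp
  qed
qed auto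

lemma converges_to_octI:
  fixes x :: "nat \<Rightarrow> 'k::real_normed_field"
  assumes "x \<in> null_seqs" "\<And>n. s n \<in> null_seqs"
    and "\<And>e. e > 0 \<Longrightarrow> \<exists>N. \<forall>n\<ge>N. \<forall>m. norm (s n m - x m) \<le> e"
  shows "converges_to oct_space s x"
  unfolding converges_to_def oct_space_simps
proof (intro conjI LIMSEQ_I)
  fix r :: real assume r: "r > 0"
  obtain N where N: "\<And>n m. n \<ge> N \<Longrightarrow> norm (s n m - x m) \<le> r / 2"
    using assms(3)[of "r/2"] r by auto
  have "enn2real (oct_norm (s n - x)) < r" if "n \<ge> N" for n
    using nrm_oct_le_of_sup[of "s n - x" "r / 2"] N[OF that] r
      null_seqs_intros(3)[OF assms(2,1)] by simp
  then show "\<exists>no. \<forall>n\<ge>no. norm (enn2real (oct_norm (s n - x)) - 0) < r"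
    by auto
qed (rule assms(1))

lemma converges_to_oct_pointwise:
  fixes x :: "nat \<Rightarrow> 'k::real_normed_field"
  assumes "converges_to oct_space s x" "\<And>n. s n \<in> null_seqs"
  shows "(\<lambda>n. s n m) \<longlonglongrightarrow> x m"
proof -
  have x: "x \<in> null_seqs" and l: "(\<lambda>n. enn2real (oct_norm (s n - x))) \<longlonglongrightarrow> 0"
    using assms(1) by (auto simp: converges_to_def)
  have "norm (s n m - x m) \<le> enn2real (oct_norm (s n - x))" for n
    using nrm_oct_bounds(1)[OF null_seqs_intros(3)[OF assms(2) x], of n m] by simp
  then have "(\<lambda>n. s n m - x m) \<longlonglongrightarrow> 0"
    by (intro metric_tendsto_imp_tendsto[OF l] always_eventually allI) auto
  then show ?thesis by (simp add: LIM_zero_iff)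
qed

lemma banach_space_oct:
  "banach_space (oct_space :: ('k::{real_normed_field, banach}, nat \<Rightarrow> 'k) nspace)"
  unfolding banach_space_def
proof (intro conjI allI impI normed_space_oct)
  fix s :: "nat \<Rightarrow> nat \<Rightarrow> 'k"
  assume "range s \<subseteq> carr oct_space \<and> cauchy_seq oct_space s"
  then have s: "\<And>n. s n \<in> null_seqs"
    and C: "\<And>e. e > 0 \<Longrightarrow> \<exists>M. \<forall>m\<ge>M. \<forall>n\<ge>M. enn2real (oct_norm (s m - s n)) < e"
    by (auto simp: cauchy_seq_def)
  have Cp: "\<exists>M. \<forall>m\<ge>M. \<forall>n\<ge>M. \<forall>i. norm (s m i - s n i) < e" if e: "e > 0" for e
  proof -
    obtain M where M: "\<And>m n. m \<ge> M \<Longrightarrow> n \<ge> M \<Longrightarrow> enn2real (oct_norm (s m - s n)) < e"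
      using C[OF e] by blast
    have "norm (s m i - s n i) < e" if "m \<ge> M" "n \<ge> M" for m n i
      using nrm_oct_bounds(1)[OF null_seqs_intros(3)[OF s s], of m n i] M[OF that] by simp
    then show ?thesis by blast
  qed
  have "convergent (\<lambda>n. s n i)" for i
  proof (rule Cauchy_convergent, rule CauchyI)
    fix e :: real assume "e > 0"
    from Cp[OF this] show "\<exists>M. \<forall>m\<ge>M. \<forall>n\<ge>M. norm (s m i - s n i) < e" by blast
  qed
  then have "(\<lambda>n. s n i) \<longlonglongrightarrow> lim (\<lambda>n. s n i)" for i
    by (simp add: convergent_LIMSEQ_iff)
  then obtain l where l: "\<And>i. (\<lambda>n. s n i) \<longlonglongrightarrow> l i"
    by (rule that)
  have u: "\<exists>N. \<forall>n\<ge>N. \<forall>m. norm (s n m - l m) \<le> e" if e: "e > 0" for e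
  proof -
    obtain M where M: "\<And>m n i. m \<ge> M \<Longrightarrow> n \<ge> M \<Longrightarrow> norm (s m i - s n i) < e"
      using Cp[OF e] by blast
    have "norm (s n i - l i) \<le> e" if "n \<ge> M" for n i
    proof (rule Lim_bounded)
      show "(\<lambda>k. norm (s n i - s k i)) \<longlonglongrightarrow> norm (s n i - l i)"
        by (intro tendsto_intros l)
      show "\<forall>k\<ge>M. norm (s n i - s k i) \<le> e"
        using M[OF that] less_imp_le by blast
    qed
    then show ?thesis by blast
  qed
  have "l \<in> null_seqs"
    unfolding null_seqs_def mem_Collect_eq
  proof (rule LIMSEQ_I)
    fix r :: real assume r: "r > 0"
    obtain N where N: "\<And>m. norm (s N m - l m) \<le> r / 2"
      using u[of "r/2"] r by auto
    obtain K where K: "\<And>m. m \<ge> K \<Longrightarrow> norm (s N m) < r / 2"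
      using LIMSEQ_D[of "s N" 0 "r/2"] s[of N] r by (auto simp: null_seqs_def)
    have "norm (l m - 0) < r" if "m \<ge> K" for m
      using N[of m] K[OF that] norm_triangle_ineq2[of "l m" "s N m"]
      by (simp add: norm_minus_commute)
    then show "\<exists>no. \<forall>n\<ge>no. norm (l n - 0) < r" by blast
  qed
  then have "converges_to oct_space s l"
    by (rule converges_to_octI) (use s u in auto)
  then show "\<exists>l. converges_to oct_space s l" by (intro exI[of _ l])
qed

section \<open>The unit vector basis and its Besselian norm\<close>

lemma sum_fun_at: "(\<Sum>m\<in>A. g m) i = (\<Sum>m\<in>A. g m i)"
  by (induction A rule: infinite_finite_induct) auto

lemma sum_unit_vec:
  fixes c :: "nat \<Rightarrow> 'k::real_normed_field" and p :: "nat \<Rightarrow> nat"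
  assumes "inj p"
  shows "(\<Sum>m<n. fun_scl (c (p m)) (unit_vec (p m))) = (\<lambda>i. if i \<in> p ` {..<n} then c i else 0)"
proof
  fix i
  have "(\<Sum>m<n. fun_scl (c (p m)) (unit_vec (p m))) i =
      (\<Sum>j\<in>p ` {..<n}. fun_scl (c j) (unit_vec j) i)"
    by (subst sum.reindex)
      (auto intro: inj_on_subset[OF assms] simp: sum_fun_at)
  also have "\<dots> = (\<Sum>j\<in>p ` {..<n}. if i = j then c j else 0)"
    by (intro sum.cong) (auto simp: fun_scl_def unit_vec_def)
  also have "\<dots> = (if i \<in> p ` {..<n} then c i else 0)"
    by (subst sum.delta') auto
  finally show "(\<Sum>m<n. fun_scl (c (p m)) (unit_vec (p m))) i =
      (if i \<in> p ` {..<n} then c i else 0)" .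
qed


lemma sum_unit_vec_id:
  "(\<Sum>m<n. fun_scl (c m) (unit_vec m)) = (\<lambda>i. if i < n then c i else (0 :: 'k::real_normed_field))"
  using sum_unit_vec[of id c n] by simp

lemma truncation_in_null_seqs:
  assumes "finite A"
  shows "(\<lambda>i. if i \<in> A then c i else 0) \<in> null_seqs"
proof -
  obtain n where "A \<subseteq> {..<n}"
    using assms finite_nat_iff_bounded by blast
  then show ?thesis
    by (intro eventually_zero_in_null_seqs[of n]) auto
qed

lemma converges_to_oct_expansion:
  fixes x :: "nat \<Rightarrow> 'k::real_normed_field"
  assumes x: "x \<in> null_seqs" and p: "bij p"
  shows "converges_to oct_space (\<lambda>n. \<Sum>m<n. fun_scl (x (p m)) (unit_vec (p m))) x"
  unfolding sum_unit_vec[OF bij_is_inj[OF p]]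
proof (rule converges_to_octI[OF x])
  fix e :: real assume e: "e > 0"
  obtain K where K: "\<And>m. m \<ge> K \<Longrightarrow> norm (x m) < e"
    using LIMSEQ_D[of x 0 e] x e by (auto simp: null_seqs_def)
  obtain N where N: "inv p ` {..<K} \<subseteq> {..<N}"
    using finite_nat_iff_bounded[of "inv p ` {..<K}"] by auto
  have "norm ((if m \<in> p ` {..<n} then x m else 0) - x m) \<le> e" if "n \<ge> N" for n m
  proof (cases "m < K")
    case True
    then have "inv p m < n" using N that by auto
    moreover have "m = p (inv p m)"
      using p by (simp add: bij_is_surj surj_f_inv_f)
    ultimately have "m \<in> p ` {..<n}" by blast
    then show ?thesis using e by simp
  next
    case False
    then show ?thesis using K[of m] e by auto
  qed
  then show "\<exists>N. \<forall>n\<ge>N. \<forall>m. norm ((if m \<in> p ` {..<n} then x m else 0) - x m) \<le> e"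
    by blast
qed (simp add: truncation_in_null_seqs)

lemma coordinate_in_dual_ball: "(\<lambda>x. x m) \<in> dual_ball oct_space"
  by (rule dual_ballI[OF normed_space_oct])
    (auto simp: fun_scl_def nrm_oct_bounds)

lemma usb_unit_basis: "usb (oct_space :: ('k::real_normed_field, nat \<Rightarrow> 'k) nspace) unit_basis"
  unfolding usb_def oct_space_simps unit_basis_simps
proof (intro conjI allI ballI impI)
  show "(\<lambda>x. x m) \<in> dual oct_space" for m
    using coordinate_in_dual_ball by (auto simp: dual_ball_def)
next
  fix x :: "nat \<Rightarrow> 'k" assume x: "x \<in> null_seqs"
  show "converges_to oct_space (\<lambda>n. \<Sum>m<n. fun_scl (x m) (unit_vec m)) x"
    using converges_to_oct_expansion[OF x, of id] by simp
next
  fix x :: "nat \<Rightarrow> 'k" and p :: "nat \<Rightarrow> nat" assume "x \<in> null_seqs" "bij p"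
  then show "\<exists>l. converges_to oct_space (\<lambda>n. \<Sum>m<n. fun_scl (x (p m)) (unit_vec (p m))) l"
    using converges_to_oct_expansion by blast
next
  fix x c :: "nat \<Rightarrow> 'k" and i :: nat
  assume "converges_to oct_space (\<lambda>n. \<Sum>m<n. fun_scl (c m) (unit_vec m)) x"
  then have "(\<lambda>n. (\<Sum>m<n. fun_scl (c m) (unit_vec m)) i) \<longlonglongrightarrow> x i"
    by (rule converges_to_oct_pointwise)
      (simp add: sum_unit_vec_id prefix_in_null_seqs)
  moreover have "(\<lambda>n. (\<Sum>m<n. fun_scl (c m) (unit_vec m)) i) \<longlonglongrightarrow> c i"
    unfolding sum_unit_vec_id
    by (intro tendsto_eventually eventually_sequentiallyI[of "Suc i"]) auto
  ultimately show "c i = x i"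
    using LIMSEQ_unique by blast
qed (rule unit_vec_in_null_seqs)

text \<open>The value at \<open>x\<close> of the modulus of \<open>f\<close>, taken entrywise with respect to the unit vectors.\<close>

definition abs_pairing :: "((nat \<Rightarrow> 'k::real_normed_field) \<Rightarrow> 'k) \<Rightarrow> (nat \<Rightarrow> 'k) \<Rightarrow> ennreal" where
  "abs_pairing f x = (\<Sum>m. ennreal (norm (x m * f (unit_vec m))))"

lemma dual_oct_finite_sum:
  assumes "f \<in> dual oct_space"
  shows "f (\<Sum>m<n. fun_scl (c m) (unit_vec m)) = (\<Sum>m<n. c m * f (unit_vec m))"
proof (induction n)
  case 0
  have "f (fun_scl 0 0) = 0 * f 0"
    using assms null_seqs_intros(1)
    by (auto simp: dual_def bounded_ops_def scalar_space_def)
  moreover have "fun_scl 0 0 = (0 :: nat \<Rightarrow> 'a)"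
    by (simp add: fun_scl_def fun_eq_iff)
  ultimately have "f 0 = 0" by simp
  then show ?case by (simp add: zero_fun_def)
next
  case (Suc n)
  have "(\<Sum>m<n. fun_scl (c m) (unit_vec m)) \<in> null_seqs"
    by (simp add: sum_unit_vec_id prefix_in_null_seqs)
  moreover have "fun_scl (c n) (unit_vec n) \<in> null_seqs"
    by (intro null_seqs_intros unit_vec_in_null_seqs)
  ultimately have "f ((\<Sum>m<n. fun_scl (c m) (unit_vec m)) + fun_scl (c n) (unit_vec n)) =
      f (\<Sum>m<n. fun_scl (c m) (unit_vec m)) + f (fun_scl (c n) (unit_vec n))"
    using assms unfolding dual_def bounded_ops_def by simp
  moreover have "f (fun_scl (c n) (unit_vec n)) = c n * f (unit_vec n)"
    using assms unfolding dual_def bounded_ops_def scalar_space_def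
    by (simp add: unit_vec_in_null_seqs)
  ultimately show ?case by (simp only: sum.lessThan_Suc Suc)
qed

lemma finite_sum_le_abs_pairing:
  assumes "finite A"
  shows "ennreal (\<Sum>m\<in>A. norm (x m * f (unit_vec m))) \<le> abs_pairing f x"
proof -
  have "(\<Sum>m\<in>A. ennreal (norm (x m * f (unit_vec m)))) \<le> abs_pairing f x"
    unfolding abs_pairing_def using assms by (intro sum_le_suminf) auto
  then show ?thesis by (simp add: sum_ennreal)
qed

text \<open>
  The finitely many entries of \<open>x\<close> below an index \<open>n\<close> can be multiplied by scalars of modulus at most \<open>1\<close> such that all
  terms of \<open>f\<close> at the resulting vector become nonnegative, and this does not increase the norm.
  No assumption on \<open>x\<close> is needed.
\<close>

lemma abs_pairing_le:
  fixes f :: "(nat \<Rightarrow> 'k::real_normed_field) \<Rightarrow> 'k"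
  assumes f: "f \<in> dual_ball oct_space"
  shows "abs_pairing f x \<le> oct_norm x"
  unfolding abs_pairing_def
proof (rule suminf_le_const)
  fix n
  \<comment> \<open>The factor \<open>s m\<close> rotates the \<open>m\<close>-th term to the nonnegative real axis.\<close>
  define s where "s m = (if x m * f (unit_vec m) = 0 then 0
      else of_real (norm (x m * f (unit_vec m))) / (x m * f (unit_vec m)))" for m
  have s: "s m * x m * f (unit_vec m) = of_real (norm (x m * f (unit_vec m)))" "norm (s m) \<le> 1" for m
    by (auto simp: s_def norm_divide)
  define z where "z = (\<lambda>i. if i < n then s i * x i else 0)"
  have z: "z \<in> null_seqs"
    unfolding z_def by (rule prefix_in_null_seqs)
  have "f z = (\<Sum>m<n. (s m * x m) * f (unit_vec m))"
    using dual_oct_finite_sum[of f "\<lambda>m. s m * x m" n] f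
    unfolding z_def sum_unit_vec_id by (simp add: dual_ball_def)
  also have "\<dots> = of_real (\<Sum>m<n. norm (x m * f (unit_vec m)))"
    by (simp add: s(1))
  finally have "norm (f z) = \<bar>\<Sum>m<n. norm (x m * f (unit_vec m))\<bar>"
    by (simp only: norm_of_real)
  then have "(\<Sum>m<n. norm (x m * f (unit_vec m))) = norm (f z)"
    by (simp add: sum_nonneg)
  also have "\<dots> \<le> enn2real (oct_norm z)"
    using norm_dual_ball_le[OF normed_space_oct f, of z] z by simp
  finally have "ennreal (\<Sum>m<n. norm (x m * f (unit_vec m))) \<le> oct_norm z"
    using oct_norm_finite[OF z] ennreal_leI by metis
  also have "\<dots> \<le> oct_norm x"
  proof (rule oct_norm_mono)
    show "norm (z m) \<le> norm (x m)" for m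
      using s(2)[of m] mult_right_mono[of "norm (s m)" 1 "norm (x m)"]
      by (simp add: z_def norm_mult)
  qed
  finally show "(\<Sum>m<n. ennreal (norm (x m * f (unit_vec m)))) \<le> oct_norm x"
    by (simp add: sum_ennreal)
qed simp

lemma norm_two_thirds: "norm (2/3 * a) = 2/3 * norm (a :: 'k::real_normed_field)"
  by (simp add: norm_mult norm_divide)

text \<open>The norming functional for the second term of the maximum in the norm.\<close>

definition oct_functional :: "(nat \<Rightarrow> 'k::real_normed_field) \<Rightarrow> 'k" where
  "oct_functional x = 2/3 * (x 0 + x 1)"

lemma oct_functional_in_dual_ball: "oct_functional \<in> dual_ball oct_space"
proof (rule dual_ballI[OF normed_space_oct])
  fix x :: "nat \<Rightarrow> 'a" assume "x \<in> carr oct_space"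
  then have "2/3 * (norm (x 0) + norm (x 1)) \<le> nrm oct_space x"
    using nrm_oct_bounds(2)[of x] by simp
  moreover have "norm (oct_functional x) \<le> 2/3 * (norm (x 0) + norm (x 1))"
    unfolding oct_functional_def norm_two_thirds
    by (intro mult_left_mono norm_triangle_ineq) simp
  ultimately show "norm (oct_functional x) \<le> nrm oct_space x" by linarith
next
  fix x y :: "nat \<Rightarrow> 'a" and c :: 'a
  \<comment> \<open>Hiding the numeral keeps the simplifier from distributing it.\<close>
  define t where "t = (2/3 :: 'a)"
  have t: "oct_functional x = t * (x 0 + x 1)" for x
    by (simp only: oct_functional_def t_def)
  show "oct_functional (x + y) = oct_functional x + oct_functional y"
    "oct_functional (scl oct_space c x) = c * oct_functional x"
    by (simp_all add: t fun_scl_def algebra_simps)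
qed

lemma le_abs_pairing_oct_functional:
  "ennreal (2/3 * (norm (x 0) + norm (x 1))) \<le> abs_pairing oct_functional x"
  using finite_sum_le_abs_pairing[of "{0, 1}" x oct_functional]
  by (simp add: oct_functional_def unit_vec_def norm_mult norm_divide algebra_simps)

lemma SUP_abs_pairing: "(SUP f\<in>dual_ball oct_space. abs_pairing f x) = oct_norm x"
proof (rule antisym)
  have "ennreal (norm (x m)) \<le> abs_pairing (\<lambda>x. x m) x" for m
    using finite_sum_le_abs_pairing[of "{m}" x "\<lambda>x. x m"] by (simp add: unit_vec_def)
  then have "ennreal (norm (x m)) \<le> (SUP f\<in>dual_ball oct_space. abs_pairing f x)" for m
    by (rule SUP_upper2[where f = "\<lambda>f. abs_pairing f x", OF coordinate_in_dual_ball])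
  moreover have "ennreal (2/3 * (norm (x 0) + norm (x 1)))
      \<le> (SUP f\<in>dual_ball oct_space. abs_pairing f x)"
    by (rule SUP_upper2[where f = "\<lambda>f. abs_pairing f x", OF oct_functional_in_dual_ball
      le_abs_pairing_oct_functional])
  ultimately show "oct_norm x \<le> (SUP f\<in>dual_ball oct_space. abs_pairing f x)"
    unfolding oct_norm_def by (intro max.boundedI SUP_least)
qed (simp add: SUP_least abs_pairing_le)

lemma bess_space_oct: "bess_space oct_space unit_basis = oct_space"
proof -
  have "bess_norm oct_space unit_basis x = enn2real (oct_norm x)" for x :: "nat \<Rightarrow> 'a"
    unfolding bess_norm_def unit_basis_simps abs_pairing_def[symmetric] SUP_abs_pairing ..
  then show ?thesis by (simp add: bess_space_def oct_space_def fun_eq_iff)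
qed

lemma norm_le_abs_pairing:
  fixes f :: "(nat \<Rightarrow> 'k::real_normed_field) \<Rightarrow> 'k"
  assumes f: "f \<in> dual_ball oct_space" and x: "x \<in> null_seqs"
  shows "ennreal (norm (f x)) \<le> abs_pairing f x"
proof -
  have fd: "f \<in> dual oct_space"
    using f by (simp add: dual_ball_def)
  define P where "P = enn2real (abs_pairing f x)"
  have "abs_pairing f x < top"
    using abs_pairing_le[OF f, of x] oct_norm_finite[OF x]
    by (metis ennreal_less_top le_less_trans)
  then have P: "abs_pairing f x = ennreal P" and P0: "0 \<le> P"
    by (simp_all add: P_def)
  define s where "s = (\<lambda>n. \<Sum>m<n. fun_scl (x m) (unit_vec m))"
  have s: "s n \<in> null_seqs" for n
    by (simp add: s_def sum_unit_vec_id prefix_in_null_seqs)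
  have "converges_to oct_space s x"
    using converges_to_oct_expansion[OF x, of id] by (simp add: s_def)
  then have lim: "(\<lambda>n. enn2real (oct_norm (s n - x))) \<longlonglongrightarrow> 0"
    by (simp add: converges_to_def)
  have "norm (f x) \<le> P + enn2real (oct_norm (s n - x))" for n
  proof -
    have "norm (f (s n)) \<le> (\<Sum>m<n. norm (x m * f (unit_vec m)))"
      unfolding s_def dual_oct_finite_sum[OF fd] by (rule norm_sum)
    also have "\<dots> \<le> P"
      using finite_sum_le_abs_pairing[of "{..<n}" x f] P0 by (simp add: P)
    finally have 1: "norm (f (s n)) \<le> P" .
    have "f ((s n - x) + x) = f (s n - x) + f x"
    proof -
      have "f (a + b) = f a + f b" if "a \<in> null_seqs" "b \<in> null_seqs" for a b
        using fd that by (simp add: dual_def bounded_ops_def)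
      then show ?thesis using null_seqs_intros(3)[OF s x] x by blast
    qed
    then have "f x = f (s n) - f (s n - x)" by simp
    then have "norm (f x) \<le> norm (f (s n)) + norm (f (s n - x))"
      by (simp add: norm_triangle_ineq4)
    also have "norm (f (s n - x)) \<le> enn2real (oct_norm (s n - x))"
      using norm_dual_ball_le[OF normed_space_oct f] null_seqs_intros(3)[OF s x] by simp
    finally show ?thesis using 1 by linarith
  qed
  then have "norm (f x) \<le> P + 0"
    by (intro LIMSEQ_le_const[OF tendsto_add[OF tendsto_const lim]]) auto
  then show ?thesis by (simp add: P ennreal_leI)
qed

text \<open>
  Normalising \<open>\<phi>\<close> gives such an \<open>f\<close>, unless \<open>\<phi>\<close> has norm \<open>0\<close>; then \<open>\<phi>\<close> vanishes on the carrier
  and any \<open>f\<close> will do.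
\<close>

lemma dual_dominated_by_abs_pairing:
  fixes \<phi> :: "(nat \<Rightarrow> 'k::real_normed_field) \<Rightarrow> 'k"
  assumes \<phi>: "\<phi> \<in> dual oct_space"
  obtains f where "f \<in> dual_ball oct_space"
    and "\<And>x. x \<in> null_seqs \<Longrightarrow>
      ennreal (norm (\<phi> x)) \<le> ennreal (dual_norm oct_space \<phi>) * abs_pairing f x"
proof (cases "dual_norm oct_space \<phi> = 0")
  case True
  then have "norm (\<phi> x) \<le> 0" if "x \<in> null_seqs" for x
    using norm_dual_le[OF normed_space_oct \<phi>, of x] that by simp
  then show thesis
    using that[OF coordinate_in_dual_ball[of 0]] by simp
next
  case False
  define d where "d = dual_norm oct_space \<phi>"
  have d: "d > 0"
    using False dual_norm_nonneg[OF normed_space_oct \<phi>] by (simp add: d_def)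
  define f where "f x = \<phi> x / of_real d" for x
  have f: "f \<in> dual_ball oct_space"
  proof (rule dual_ballI[OF normed_space_oct])
    fix x :: "nat \<Rightarrow> 'k" assume "x \<in> carr oct_space"
    then have "norm (\<phi> x) \<le> d * nrm oct_space x"
      using norm_dual_le[OF normed_space_oct \<phi>, of x] by (simp add: d_def)
    then show "norm (f x) \<le> nrm oct_space x"
      using d by (simp add: f_def norm_divide field_simps)
  qed (use \<phi> in \<open>auto simp: f_def dual_def bounded_ops_def scalar_space_def add_divide_distrib\<close>)
  have "ennreal (norm (\<phi> x)) \<le> ennreal d * abs_pairing f x" if "x \<in> null_seqs" for x
  proof -
    have "norm (\<phi> x) = d * norm (f x)"
      using d by (simp add: f_def norm_divide)
    then have "ennreal (norm (\<phi> x)) = ennreal d * ennreal (norm (f x))"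
      using d by (simp add: ennreal_mult)
    then show ?thesis
      using norm_le_abs_pairing[OF f that] by (simp add: mult_left_mono)
  qed
  then show thesis using that[OF f] by (simp add: d_def)
qed

section \<open>The Besselian crossnorm\<close>

text \<open>
  \<open>rep_sum zs\<close> is the quantity of which the Besselian crossnorm is the infimum over all
  representations \<open>zs\<close>. It is a real number, which loses nothing for vectors in the carrier, where
  the supremum is finite (\<open>bess_sum_finite\<close>).
\<close>

abbreviation rep_sum :: "((nat \<Rightarrow> 'k::real_normed_field) \<times> (nat \<Rightarrow> 'k)) list \<Rightarrow> real" where
  "rep_sum zs \<equiv> enn2real (bess_sum oct_space unit_basis oct_space unit_basis zs)"

abbreviation oct_cross :: "('k::real_normed_field, nat \<Rightarrow> 'k, nat \<Rightarrow> 'k) tensor \<Rightarrow> real" where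
  "oct_cross \<equiv> bess_crossnorm oct_space unit_basis oct_space unit_basis"

abbreviation oct_tensors :: "('k::real_normed_field, nat \<Rightarrow> 'k, nat \<Rightarrow> 'k) tensor set" where
  "oct_tensors \<equiv> tensor_product oct_space oct_space"

lemma bess_sum_oct:
  "bess_sum oct_space unit_basis oct_space unit_basis zs =
    (SUP (f, g)\<in>dual_ball oct_space \<times> dual_ball oct_space.
      \<Sum>(x, y)\<leftarrow>zs. abs_pairing f x * abs_pairing g y)"
proof -
  have "(\<Sum>m. \<Sum>n. ennreal (norm (x m * y n * f (unit_vec m) * g (unit_vec n)))) =
      abs_pairing f x * abs_pairing g y" for x y :: "nat \<Rightarrow> 'a" and f g
  proof -
    have "ennreal (norm (x m * y n * f (unit_vec m) * g (unit_vec n))) =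
        ennreal (norm (x m * f (unit_vec m))) * ennreal (norm (y n * g (unit_vec n)))" for m n
      by (simp add: norm_mult ennreal_mult[symmetric] mult_ac)
    then show ?thesis
      by (simp add: abs_pairing_def)
  qed
  then show ?thesis by (simp add: bess_sum_def)
qed

lemma pairing_sum_le_bess_sum:
  assumes "f \<in> dual_ball oct_space" "g \<in> dual_ball oct_space"
  shows "(\<Sum>(x, y)\<leftarrow>zs. abs_pairing f x * abs_pairing g y)
    \<le> bess_sum oct_space unit_basis oct_space unit_basis zs"
  unfolding bess_sum_oct using assms by (intro SUP_upper2[of "(f, g)"]) auto

lemma bess_sum_le:
  assumes "\<And>f g. f \<in> dual_ball oct_space \<Longrightarrow> g \<in> dual_ball oct_space \<Longrightarrow>
    (\<Sum>(x, y)\<leftarrow>zs. abs_pairing f x * abs_pairing g y) \<le> B"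
  shows "bess_sum oct_space unit_basis oct_space unit_basis zs \<le> B"
  unfolding bess_sum_oct using assms by (intro SUP_least) auto

lemma bess_sum_le_oct_norms:
  "bess_sum oct_space unit_basis oct_space unit_basis zs
    \<le> (\<Sum>(x, y)\<leftarrow>zs. oct_norm x * oct_norm y)"
  by (intro bess_sum_le sum_list_mono) (auto intro!: mult_mono abs_pairing_le)

lemma bess_sum_finite:
  assumes "set zs \<subseteq> null_seqs \<times> null_seqs"
  shows "bess_sum oct_space unit_basis oct_space unit_basis zs = ennreal (rep_sum zs)"
proof -
  have "(\<Sum>(x, y)\<leftarrow>zs. oct_norm x * oct_norm y) < top"
    using assms
  proof (induction zs)
    case (Cons z zs)
    obtain x y where z: "z = (x, y)" "x \<in> null_seqs" "y \<in> null_seqs"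
      using Cons.prems by auto
    have "oct_norm x < top" "oct_norm y < top"
      using oct_norm_finite[OF z(2)] oct_norm_finite[OF z(3)] by (metis ennreal_less_top)+
    then show ?case
      using Cons z by (simp add: ennreal_mult_less_top)
  qed simp
  then show ?thesis
    using bess_sum_le_oct_norms[of zs] by (simp add: le_less_trans)
qed

lemma oct_cross_le_rep_sum:
  assumes "set zs \<subseteq> null_seqs \<times> null_seqs"
  shows "oct_cross (tensor_of oct_space oct_space zs) \<le> rep_sum zs"
  unfolding bess_crossnorm_def
proof (rule enn2real_mono)
  show "(INF ws\<in>{ws. set ws \<subseteq> carr oct_space \<times> carr oct_space \<and>
        tensor_of oct_space oct_space ws = tensor_of oct_space oct_space zs}.
      bess_sum oct_space unit_basis oct_space unit_basis ws)
    \<le> bess_sum oct_space unit_basis oct_space unit_basis zs"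
    using assms by (intro INF_lower) simp
  show "bess_sum oct_space unit_basis oct_space unit_basis zs < top"
    using bess_sum_finite[OF assms] by (metis ennreal_less_top)
qed

text \<open>
  Lower bounds on the crossnorm are shown by checking them on every representation. The constant
  \<open>c\<close> makes the rule applicable to bounds that are proportional to the crossnorm.
\<close>

lemma le_oct_crossI:
  assumes u: "u \<in> oct_tensors" and c: "0 \<le> c"
    and le: "\<And>zs. set zs \<subseteq> null_seqs \<times> null_seqs \<Longrightarrow> tensor_of oct_space oct_space zs = u \<Longrightarrow>
      B \<le> c * rep_sum zs"
  shows "B \<le> c * oct_cross u"
proof (cases "c = 0")
  case True
  obtain zs where "set zs \<subseteq> null_seqs \<times> null_seqs" "tensor_of oct_space oct_space zs = u"
    using u by (auto simp: tensor_product_def)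
  from le[OF this] True show ?thesis by simp
next
  case False
  then have c: "c > 0" using c by simp
  obtain zs0 where zs0: "set zs0 \<subseteq> null_seqs \<times> null_seqs" "tensor_of oct_space oct_space zs0 = u"
    using u by (auto simp: tensor_product_def)
  let ?R = "{zs. set zs \<subseteq> carr oct_space \<times> carr oct_space \<and> tensor_of oct_space oct_space zs = u}"
  let ?I = "INF zs\<in>?R. bess_sum oct_space unit_basis oct_space unit_basis zs"
  have "?I \<le> bess_sum oct_space unit_basis oct_space unit_basis zs0"
    using zs0 by (intro INF_lower) simp
  also have "\<dots> < top"
    using bess_sum_finite[OF zs0(1)] by (metis ennreal_less_top)
  finally have I: "?I = ennreal (oct_cross u)"
    by (simp add: bess_crossnorm_def)
  have "ennreal (B / c) \<le> ?I"
  proof (rule INF_greatest)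
    fix zs assume "zs \<in> ?R"
    then have zs: "set zs \<subseteq> null_seqs \<times> null_seqs" "tensor_of oct_space oct_space zs = u"
      by auto
    have "B / c \<le> rep_sum zs"
      using le[OF zs] c by (simp add: field_simps)
    then show "ennreal (B / c) \<le> bess_sum oct_space unit_basis oct_space unit_basis zs"
      using bess_sum_finite[OF zs(1)] by (metis ennreal_leI)
  qed
  then have "B / c \<le> oct_cross u"
    unfolding I by (simp add: bess_crossnorm_def)
  then show ?thesis using c by (simp add: field_simps)
qed

lemma product_form_bilinear:
  assumes "\<phi> \<in> dual X" "\<psi> \<in> dual Y"
  shows "(\<lambda>x y. \<phi> x * \<psi> y) \<in> bilinear_forms X Y"
  using assms by (auto simp: bilinear_forms_def dual_def bounded_ops_def scalar_space_def algebra_simps)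

lemma coordinate_in_dual: "(\<lambda>x. x m) \<in> dual oct_space"
  using coordinate_in_dual_ball unfolding dual_ball_def by blast

lemma entry_form_bilinear: "(\<lambda>x y. x m * y n) \<in> bilinear_forms oct_space oct_space"
  by (intro product_form_bilinear coordinate_in_dual)

lemma norm_sum_list_le_mult_sum_list:
  fixes h :: "'z \<Rightarrow> 'k::real_normed_field" and k :: "'z \<Rightarrow> ennreal"
  assumes "\<And>z. z \<in> set zs \<Longrightarrow> ennreal (norm (h z)) \<le> c * k z"
  shows "ennreal (norm (\<Sum>z\<leftarrow>zs. h z)) \<le> c * (\<Sum>z\<leftarrow>zs. k z)"
  using assms
proof (induction zs)
  case (Cons z zs)
  have "ennreal (norm (h z + sum_list (map h zs))) \<le>
      ennreal (norm (h z)) + ennreal (norm (sum_list (map h zs)))"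
    by (simp add: ennreal_plus[symmetric] norm_triangle_ineq ennreal_leI del: ennreal_plus)
  also have "\<dots> \<le> c * k z + c * sum_list (map k zs)"
    using Cons by (intro add_mono) auto
  finally show ?case by (simp add: distrib_left)
qed simp

lemma oct_cross_dual_le:
  fixes u :: "('k::real_normed_field, nat \<Rightarrow> 'k, nat \<Rightarrow> 'k) tensor"
  assumes \<phi>: "\<phi> \<in> dual oct_space" and \<psi>: "\<psi> \<in> dual oct_space" and u: "u \<in> oct_tensors"
  shows "norm (u (\<lambda>x y. \<phi> x * \<psi> y))
    \<le> dual_norm oct_space \<phi> * dual_norm oct_space \<psi> * oct_cross u"
proof (rule le_oct_crossI[OF u])
  let ?d = "dual_norm oct_space \<phi>" and ?e = "dual_norm oct_space \<psi>"
  show de: "0 \<le> ?d * ?e"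
    using dual_norm_nonneg[OF normed_space_oct \<phi>] dual_norm_nonneg[OF normed_space_oct \<psi>] by simp
  fix zs :: "((nat \<Rightarrow> 'k) \<times> (nat \<Rightarrow> 'k)) list"
  assume zs: "set zs \<subseteq> null_seqs \<times> null_seqs" "tensor_of oct_space oct_space zs = u"
  obtain f where f: "f \<in> dual_ball oct_space"
    "\<And>x. x \<in> null_seqs \<Longrightarrow> ennreal (norm (\<phi> x)) \<le> ennreal ?d * abs_pairing f x"
    using dual_dominated_by_abs_pairing[OF \<phi>] by blast
  obtain g where g: "g \<in> dual_ball oct_space"
    "\<And>y. y \<in> null_seqs \<Longrightarrow> ennreal (norm (\<psi> y)) \<le> ennreal ?e * abs_pairing g y"
    using dual_dominated_by_abs_pairing[OF \<psi>] by blast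
  have "u (\<lambda>x y. \<phi> x * \<psi> y) = (\<Sum>z\<leftarrow>zs. \<phi> (fst z) * \<psi> (snd z))"
    using product_form_bilinear[OF \<phi> \<psi>]
    by (simp add: zs(2)[symmetric] tensor_of_def case_prod_unfold)
  then have "ennreal (norm (u (\<lambda>x y. \<phi> x * \<psi> y))) \<le>
      ennreal (?d * ?e) * (\<Sum>z\<leftarrow>zs. abs_pairing f (fst z) * abs_pairing g (snd z))"
  proof (simp only:, intro norm_sum_list_le_mult_sum_list)
    fix z assume "z \<in> set zs"
    then have z: "fst z \<in> null_seqs" "snd z \<in> null_seqs" using zs by auto
    have "ennreal (norm (\<phi> (fst z) * \<psi> (snd z))) =
        ennreal (norm (\<phi> (fst z))) * ennreal (norm (\<psi> (snd z)))"
      by (simp add: norm_mult ennreal_mult)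
    also have "\<dots> \<le> (ennreal ?d * abs_pairing f (fst z)) * (ennreal ?e * abs_pairing g (snd z))"
      using f(2)[OF z(1)] g(2)[OF z(2)] by (intro mult_mono) auto
    finally show "ennreal (norm (\<phi> (fst z) * \<psi> (snd z))) \<le>
        ennreal (?d * ?e) * (abs_pairing f (fst z) * abs_pairing g (snd z))"
      using dual_norm_nonneg[OF normed_space_oct \<phi>] dual_norm_nonneg[OF normed_space_oct \<psi>]
      by (simp add: ennreal_mult mult_ac)
  qed
  also have "\<dots> \<le> ennreal (?d * ?e) * ennreal (rep_sum zs)"
    using pairing_sum_le_bess_sum[OF f(1) g(1), of zs] bess_sum_finite[OF zs(1)]
    by (intro mult_left_mono) (auto simp: case_prod_unfold)
  finally show "norm (u (\<lambda>x y. \<phi> x * \<psi> y)) \<le> ?d * ?e * rep_sum zs"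
    using de by (simp add: ennreal_mult[symmetric])
qed

text \<open>
  The bilinear forms that define the algebraic tensor product need not be continuous, so that the
  entries do not determine their values by approximation. Instead one elementary tensor is
  eliminated: if \<open>x\<^sup>1\<^sub>m \<noteq> 0\<close>, then row \<open>m\<close> of the hypothesis expresses \<open>y\<^sup>1\<close> by the other \<open>y\<^sup>r\<close>, and the sum
  becomes that of the \<open>(x\<^sup>r - (x\<^sup>r\<^sub>m / x\<^sup>1\<^sub>m) x\<^sup>1) \<otimes> y\<^sup>r\<close> for \<open>r \<ge> 2\<close>, with the same entries.
\<close>

lemma tensor_of_eq_zero:
  fixes zs :: "((nat \<Rightarrow> 'k::real_normed_field) \<times> (nat \<Rightarrow> 'k)) list"
  assumes "set zs \<subseteq> null_seqs \<times> null_seqs"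
    and "\<And>m n. (\<Sum>(x, y)\<leftarrow>zs. x m * y n) = 0"
  shows "tensor_of oct_space oct_space zs = 0"
proof
  fix B :: "(nat \<Rightarrow> 'k) \<Rightarrow> (nat \<Rightarrow> 'k) \<Rightarrow> 'k"
  have "(\<Sum>(x, y)\<leftarrow>zs. B x y) = 0" if B: "B \<in> bilinear_forms oct_space oct_space"
    using assms
  proof (induction "length zs" arbitrary: zs)
    case 0
    then show ?case by simp
  next
    case (Suc k)
    have Badd1: "B (x + x') y = B x y + B x' y"
      if "x \<in> null_seqs" "x' \<in> null_seqs" "y \<in> null_seqs" for x x' y
      using B that by (simp add: bilinear_forms_def)
    have Bscl1: "B (fun_scl c x) y = c * B x y"
      if "x \<in> null_seqs" "y \<in> null_seqs" for c x y
      using B that by (simp add: bilinear_forms_def)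
    have Badd2: "B x (y + y') = B x y + B x y'"
      if "x \<in> null_seqs" "y \<in> null_seqs" "y' \<in> null_seqs" for x y y'
      using B that by (simp add: bilinear_forms_def)
    have Bscl2: "B x (fun_scl c y) = c * B x y"
      if "x \<in> null_seqs" "y \<in> null_seqs" for c x y
      using B that by (simp add: bilinear_forms_def)
    have scl0: "fun_scl 0 x = 0" for x :: "nat \<Rightarrow> 'k"
      by (simp add: fun_scl_def fun_eq_iff)
    obtain x1 y1 ws where zs: "zs = (x1, y1) # ws" and len: "length ws = k"
      using Suc.hyps(2) by (metis length_Suc_conv surj_pair)
    have x1: "x1 \<in> null_seqs" and y1: "y1 \<in> null_seqs" and ws: "set ws \<subseteq> null_seqs \<times> null_seqs"
      using Suc.prems(1) zs by auto
    show ?case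
    proof (cases "x1 = 0")
      case True
      have "B x1 y1 = 0"
        using Bscl1[OF x1 y1, of 0] True scl0 by simp
      moreover have "(\<Sum>(x, y)\<leftarrow>ws. B x y) = 0"
        using Suc.hyps(1)[of ws] len ws Suc.prems(2) zs True by simp
      ultimately show ?thesis by (simp add: zs)
    next
      case False
      then obtain m where m: "x1 m \<noteq> 0" by (auto simp: fun_eq_iff)
      define h where "h z = (fst z + fun_scl (- fst z m / x1 m) x1, snd z)"
        for z :: "(nat \<Rightarrow> 'k) \<times> (nat \<Rightarrow> 'k)"
      have h: "set (map h ws) \<subseteq> null_seqs \<times> null_seqs"
        using ws x1 by (auto simp: h_def intro!: null_seqs_intros)
      have col: "(\<Sum>z\<leftarrow>ws. fst z m * snd z n) = - (x1 m * y1 n)" for n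
        using Suc.prems(2)[of m n] zs
        by (simp add: case_prod_unfold eq_neg_iff_add_eq_0 add.commute)
      have "(\<Sum>(x, y)\<leftarrow>map h ws. B x y) = 0"
      proof (rule Suc.hyps(1))
        show "k = length (map h ws)" using len by simp
        show "set (map h ws) \<subseteq> null_seqs \<times> null_seqs" by (rule h)
        fix i n
        have "(\<Sum>(x, y)\<leftarrow>map h ws. x i * y n) =
            (\<Sum>z\<leftarrow>ws. fst z i * snd z n) - x1 i / x1 m * (\<Sum>z\<leftarrow>ws. fst z m * snd z n)"
          by (induction ws) (auto simp: h_def fun_scl_def algebra_simps case_prod_unfold)
        also have "\<dots> = x1 i * y1 n + (\<Sum>z\<leftarrow>ws. fst z i * snd z n)"
          using m by (simp add: col)
        also have "\<dots> = 0"
          using Suc.prems(2)[of i n] zs by (simp add: case_prod_unfold)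
        finally show "(\<Sum>(x, y)\<leftarrow>map h ws. x i * y n) = 0" .
      qed
      moreover have "(\<Sum>(x, y)\<leftarrow>map h ws. B x y) =
          (\<Sum>(x, y)\<leftarrow>ws. B x y) - (\<Sum>z\<leftarrow>ws. fst z m * B x1 (snd z)) / x1 m"
        using ws
      proof (induction ws)
        case (Cons z ws)
        then have "fst z \<in> null_seqs" "snd z \<in> null_seqs" by auto
        then have "B (fst (h z)) (snd (h z)) = B (fst z) (snd z) - fst z m * B x1 (snd z) / x1 m"
          using x1 by (simp add: h_def Badd1 Bscl1 null_seqs_intros)
        then show ?case
          using Cons by (simp add: case_prod_unfold add_divide_distrib)
      qed simp
      moreover have "(\<Sum>z\<leftarrow>ws. fst z m * B x1 (snd z)) = - (x1 m * B x1 y1)"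
      proof -
        have "(\<Sum>z\<leftarrow>ws. fun_scl (fst z m) (snd z)) \<in> null_seqs \<and>
            B x1 (\<Sum>z\<leftarrow>ws. fun_scl (fst z m) (snd z)) = (\<Sum>z\<leftarrow>ws. fst z m * B x1 (snd z))"
          using ws
        proof (induction ws)
          case Nil
          have "B x1 0 = 0" using Bscl2[OF x1 x1, of 0] scl0 by simp
          then show ?case using null_seqs_intros(1) by (simp add: zero_fun_def)
        next
          case (Cons z ws)
          then have "snd z \<in> null_seqs" by auto
          moreover from this have "fun_scl (fst z m) (snd z) \<in> null_seqs"
            by (rule null_seqs_intros)
          moreover have "(\<Sum>z\<leftarrow>ws. fun_scl (fst z m) (snd z)) \<in> null_seqs"
            "B x1 (\<Sum>z\<leftarrow>ws. fun_scl (fst z m) (snd z)) = (\<Sum>z\<leftarrow>ws. fst z m * B x1 (snd z))"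
            using Cons by auto
          ultimately show ?case
            by (simp only: list.map sum_list.Cons null_seqs_intros Badd2 Bscl2 x1 simp_thms)
        qed
        moreover have "(\<Sum>z\<leftarrow>ws. fun_scl (fst z m) (snd z)) = fun_scl (- x1 m) y1"
        proof
          fix n
          have "(\<Sum>z\<leftarrow>ws. fun_scl (fst z m) (snd z)) n = (\<Sum>z\<leftarrow>ws. fst z m * snd z n)"
            by (induction ws) (auto simp: fun_scl_def)
          then show "(\<Sum>z\<leftarrow>ws. fun_scl (fst z m) (snd z)) n = fun_scl (- x1 m) y1 n"
            using col[of n] by (simp add: fun_scl_def)
        qed
        ultimately show ?thesis using Bscl2[OF x1 y1, of "- x1 m"] by simp
      qed
      ultimately have "B x1 y1 + (\<Sum>(x, y)\<leftarrow>ws. B x y) = 0"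
        using m by (simp add: field_simps)
      then show ?thesis by (simp add: zs)
    qed
  qed
  then show "tensor_of oct_space oct_space zs B = 0 B"
    by (simp add: tensor_of_def)
qed

lemma tensor_of_append:
  "tensor_of X Y (zs @ ws) = tensor_of X Y zs + tensor_of X Y ws"
  by (auto simp: tensor_of_def fun_eq_iff)

lemma tensor_of_scl:
  assumes "set zs \<subseteq> carr X \<times> carr Y"
  shows "tensor_of X Y (map (\<lambda>(x, y). (scl X c x, y)) zs) = fun_scl c (tensor_of X Y zs)"
proof
  fix B
  have "(\<Sum>(x, y)\<leftarrow>map (\<lambda>(x, y). (scl X c x, y)) zs. B x y) = c * (\<Sum>(x, y)\<leftarrow>zs. B x y)"
    if "B \<in> bilinear_forms X Y"
    using assms that by (induction zs) (auto simp: bilinear_forms_def algebra_simps)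
  then show "tensor_of X Y (map (\<lambda>(x, y). (scl X c x, y)) zs) B = fun_scl c (tensor_of X Y zs) B"
    by (simp add: tensor_of_def fun_scl_def)
qed

lemma rep_sum_append:
  assumes "set zs \<subseteq> null_seqs \<times> null_seqs" "set ws \<subseteq> null_seqs \<times> null_seqs"
  shows "rep_sum (zs @ ws) \<le> rep_sum zs + rep_sum ws"
proof -
  have "bess_sum oct_space unit_basis oct_space unit_basis (zs @ ws) \<le>
      bess_sum oct_space unit_basis oct_space unit_basis zs +
      bess_sum oct_space unit_basis oct_space unit_basis ws"
    by (rule bess_sum_le) (simp add: add_mono pairing_sum_le_bess_sum)
  then have "ennreal (rep_sum (zs @ ws)) \<le> ennreal (rep_sum zs + rep_sum ws)"
    using assms by (simp add: bess_sum_finite[symmetric])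
  then show ?thesis by (simp del: ennreal_plus)
qed

lemma rep_sum_scl:
  assumes "set zs \<subseteq> null_seqs \<times> null_seqs"
  shows "rep_sum (map (\<lambda>(x, y). (fun_scl c x, y)) zs) \<le> norm c * rep_sum zs"
proof -
  have P: "abs_pairing f (fun_scl c x) = ennreal (norm c) * abs_pairing f x" for f x
    by (simp add: abs_pairing_def fun_scl_def norm_mult ennreal_mult mult.assoc)
  have "(\<Sum>(x, y)\<leftarrow>map (\<lambda>(x, y). (fun_scl c x, y)) zs. abs_pairing f x * abs_pairing g y) =
      ennreal (norm c) * (\<Sum>(x, y)\<leftarrow>zs. abs_pairing f x * abs_pairing g y)" for f g
    by (induction zs) (auto simp: P distrib_left mult.assoc)
  then have "bess_sum oct_space unit_basis oct_space unit_basis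
      (map (\<lambda>(x, y). (fun_scl c x, y)) zs) \<le> ennreal (norm c) * ennreal (rep_sum zs)"
    using pairing_sum_le_bess_sum bess_sum_finite[OF assms]
    by (intro bess_sum_le) (auto intro!: mult_left_mono)
  moreover have "set (map (\<lambda>(x, y). (fun_scl c x, y)) zs) \<subseteq> null_seqs \<times> null_seqs"
    using assms by (auto intro: null_seqs_intros)
  ultimately have "ennreal (rep_sum (map (\<lambda>(x, y). (fun_scl c x, y)) zs))
      \<le> ennreal (norm c) * ennreal (rep_sum zs)"
    by (subst bess_sum_finite[symmetric])
  also have "\<dots> = ennreal (norm c * rep_sum zs)"
    by (simp add: ennreal_mult)
  finally show ?thesis by (subst (asm) ennreal_le_iff) auto
qed

lemma oct_tensorsE:
  assumes "u \<in> oct_tensors"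
  obtains zs where "set zs \<subseteq> null_seqs \<times> null_seqs" "u = tensor_of oct_space oct_space zs"
  using assms by (auto simp: tensor_product_def)

lemma oct_tensors_intros:
  fixes u v :: "('k::real_normed_field, nat \<Rightarrow> 'k, nat \<Rightarrow> 'k) tensor"
  shows "set zs \<subseteq> null_seqs \<times> null_seqs \<Longrightarrow>
    tensor_of oct_space oct_space zs \<in> (oct_tensors :: ('k, nat \<Rightarrow> 'k, nat \<Rightarrow> 'k) tensor set)"
  and "(0 :: ('k, nat \<Rightarrow> 'k, nat \<Rightarrow> 'k) tensor) \<in> oct_tensors"
  and "u \<in> oct_tensors \<Longrightarrow> v \<in> oct_tensors \<Longrightarrow> u + v \<in> oct_tensors"
  and "u \<in> oct_tensors \<Longrightarrow> fun_scl c u \<in> oct_tensors"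
proof -
  show I: "tensor_of oct_space oct_space zs \<in> oct_tensors"
    if "set zs \<subseteq> null_seqs \<times> null_seqs" for zs :: "((nat \<Rightarrow> 'k) \<times> (nat \<Rightarrow> 'k)) list"
    using that by (auto simp: tensor_product_def)
  have "tensor_of oct_space oct_space [] = (0 :: ('k, nat \<Rightarrow> 'k, nat \<Rightarrow> 'k) tensor)"
    by (simp add: tensor_of_def fun_eq_iff)
  then show "(0 :: ('k, nat \<Rightarrow> 'k, nat \<Rightarrow> 'k) tensor) \<in> oct_tensors"
    using I[of "[]"] by simp
  show "u + v \<in> oct_tensors" if "u \<in> oct_tensors" "v \<in> oct_tensors"
  proof -
    obtain zs where zs: "set zs \<subseteq> null_seqs \<times> null_seqs" "u = tensor_of oct_space oct_space zs"
      by (rule oct_tensorsE[OF \<open>u \<in> oct_tensors\<close>])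
    obtain ws where ws: "set ws \<subseteq> null_seqs \<times> null_seqs" "v = tensor_of oct_space oct_space ws"
      by (rule oct_tensorsE[OF \<open>v \<in> oct_tensors\<close>])
    from zs ws show ?thesis using I[of "zs @ ws"] by (simp add: tensor_of_append)
  qed
  show "fun_scl c u \<in> oct_tensors" if "u \<in> oct_tensors"
  proof -
    obtain zs where zs: "set zs \<subseteq> null_seqs \<times> null_seqs" "u = tensor_of oct_space oct_space zs"
      by (rule oct_tensorsE[OF \<open>u \<in> oct_tensors\<close>])
    then have "set (map (\<lambda>(x, y). (fun_scl c x, y)) zs) \<subseteq> null_seqs \<times> null_seqs"
      by (auto intro: null_seqs_intros)
    from I[OF this] show ?thesis
      using tensor_of_scl[of zs oct_space oct_space c] zs by simp
  qed
qed

lemma oct_cross_scl_le: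
  assumes u: "u \<in> oct_tensors"
  shows "oct_cross (fun_scl c u) \<le> norm c * oct_cross u"
proof (rule le_oct_crossI[OF u])
  fix zs :: "((nat \<Rightarrow> 'a) \<times> (nat \<Rightarrow> 'a)) list"
  assume zs: "set zs \<subseteq> null_seqs \<times> null_seqs" "tensor_of oct_space oct_space zs = u"
  then have "set (map (\<lambda>(x, y). (fun_scl c x, y)) zs) \<subseteq> null_seqs \<times> null_seqs"
    by (auto intro: null_seqs_intros)
  from oct_cross_le_rep_sum[OF this] rep_sum_scl[OF zs(1), of c]
  show "oct_cross (fun_scl c u) \<le> norm c * rep_sum zs"
    using tensor_of_scl[of zs oct_space oct_space c] zs by simp
qed simp

lemma oct_cross_nonneg: "0 \<le> oct_cross u"
  by (simp add: bess_crossnorm_def)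

lemma oct_cross_zero: "oct_cross 0 = 0"
proof -
  have "tensor_of oct_space oct_space [] = (0 :: ('a, nat \<Rightarrow> 'a, nat \<Rightarrow> 'a) tensor)"
    by (simp add: tensor_of_def fun_eq_iff)
  moreover have "rep_sum ([] :: ((nat \<Rightarrow> 'a) \<times> (nat \<Rightarrow> 'a)) list) \<le> 0"
    using bess_sum_le_oct_norms[of "[] :: ((nat \<Rightarrow> 'a) \<times> (nat \<Rightarrow> 'a)) list"] by simp
  ultimately have "oct_cross (0 :: ('a, nat \<Rightarrow> 'a, nat \<Rightarrow> 'a) tensor) \<le> 0"
    using oct_cross_le_rep_sum[of "[] :: ((nat \<Rightarrow> 'a) \<times> (nat \<Rightarrow> 'a)) list"] by simp
  then show ?thesis by (simp add: bess_crossnorm_def antisym)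
qed

lemma oct_cross_triangle:
  assumes u: "u \<in> oct_tensors" and v: "v \<in> oct_tensors"
  shows "oct_cross (u + v) \<le> oct_cross u + oct_cross v"
proof -
  have "oct_cross (u + v) - oct_cross v \<le> 1 * oct_cross u"
  proof (rule le_oct_crossI[OF u])
    fix zs :: "((nat \<Rightarrow> 'a) \<times> (nat \<Rightarrow> 'a)) list"
    assume zs: "set zs \<subseteq> null_seqs \<times> null_seqs" "tensor_of oct_space oct_space zs = u"
    have "oct_cross (u + v) - rep_sum zs \<le> 1 * oct_cross v"
    proof (rule le_oct_crossI[OF v])
      fix ws :: "((nat \<Rightarrow> 'a) \<times> (nat \<Rightarrow> 'a)) list"
      assume ws: "set ws \<subseteq> null_seqs \<times> null_seqs" "tensor_of oct_space oct_space ws = v"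
      show "oct_cross (u + v) - rep_sum zs \<le> 1 * rep_sum ws"
        using oct_cross_le_rep_sum[of "zs @ ws"] rep_sum_append[OF zs(1) ws(1)] zs ws
        by (simp add: tensor_of_append)
    qed simp
    then show "oct_cross (u + v) - oct_cross v \<le> 1 * rep_sum zs" by simp
  qed simp
  then show ?thesis by simp
qed

lemma oct_cross_eq_zero_imp:
  fixes u :: "('k::real_normed_field, nat \<Rightarrow> 'k, nat \<Rightarrow> 'k) tensor"
  assumes u: "u \<in> oct_tensors" and "oct_cross u = 0"
  shows "u = 0"
proof -
  obtain zs where zs: "set zs \<subseteq> null_seqs \<times> null_seqs" "u = tensor_of oct_space oct_space zs"
    using u by (rule oct_tensorsE)
  have "(\<Sum>(x, y)\<leftarrow>zs. x m * y n) = 0" for m n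
  proof -
    have "norm (u (\<lambda>x y. x m * y n)) \<le> 0"
      using oct_cross_dual_le[OF coordinate_in_dual[of m] coordinate_in_dual[of n] u] assms(2)
      by simp
    then show ?thesis
      by (simp add: zs(2) tensor_of_def entry_form_bilinear)
  qed
  then show ?thesis using tensor_of_eq_zero[OF zs(1)] zs(2) by simp
qed

lemma reasonable_crossnorm_oct:
  "reasonable_crossnorm (oct_space :: ('k::{real_normed_field, banach}, nat \<Rightarrow> 'k) nspace)
    oct_space oct_cross"
  unfolding reasonable_crossnorm_def
proof (intro conjI ballI banach_space_oct)
  show "normed_space \<lparr>scl = fun_scl, carr = oct_tensors,
      nrm = oct_cross :: ('k, nat \<Rightarrow> 'k, nat \<Rightarrow> 'k) tensor \<Rightarrow> real\<rparr>"
    unfolding normed_space_def nspace.simps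
  proof (intro conjI ballI allI)
    show "vector_space (fun_scl :: 'k \<Rightarrow> ('k, nat \<Rightarrow> 'k, nat \<Rightarrow> 'k) tensor \<Rightarrow> _)"
      by (rule vector_space_fun_scl)
    show "module.subspace fun_scl (oct_tensors :: ('k, nat \<Rightarrow> 'k, nat \<Rightarrow> 'k) tensor set)"
      by (auto simp: module.subspace_def[OF module_fun_scl] intro: oct_tensors_intros)
  next
    fix u :: "('k, nat \<Rightarrow> 'k, nat \<Rightarrow> 'k) tensor" assume "u \<in> oct_tensors"
    then show "(oct_cross u = 0) = (u = 0)"
      using oct_cross_eq_zero_imp oct_cross_zero by blast
  next
    fix c and u :: "('k, nat \<Rightarrow> 'k, nat \<Rightarrow> 'k) tensor" assume u: "u \<in> oct_tensors"
    show "oct_cross (fun_scl c u) = norm c * oct_cross u"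
    proof (cases "c = 0")
      case True
      then have "fun_scl c u = 0" by (simp add: fun_scl_def fun_eq_iff)
      then show ?thesis using True by (simp add: oct_cross_zero)
    next
      case False
      have "fun_scl (inverse c) (fun_scl c u) = u"
        using False by (simp add: fun_scl_def fun_eq_iff)
      then have "oct_cross u \<le> norm (inverse c) * oct_cross (fun_scl c u)"
        using oct_cross_scl_le[OF oct_tensors_intros(4)[OF u], of "inverse c" c] by simp
      then have "oct_cross u \<le> oct_cross (fun_scl c u) / norm c"
        by (simp add: norm_inverse divide_inverse mult.commute)
      then have "norm c * oct_cross u \<le> oct_cross (fun_scl c u)"
        using False by (subst (asm) pos_le_divide_eq) (auto simp: mult.commute)
      then show ?thesis using oct_cross_scl_le[OF u, of c] by simp
    qed
  qed (auto simp: oct_cross_triangle oct_cross_nonneg)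
next
  fix x y :: "nat \<Rightarrow> 'k" assume "x \<in> carr oct_space" "y \<in> carr oct_space"
  then have xy: "x \<in> null_seqs" "y \<in> null_seqs" by auto
  have "bess_sum oct_space unit_basis oct_space unit_basis [(x, y)] \<le> oct_norm x * oct_norm y"
    using bess_sum_le_oct_norms[of "[(x, y)]"] by simp
  then have "rep_sum [(x, y)] \<le> enn2real (oct_norm x * oct_norm y)"
    using oct_norm_finite[OF xy(1)] oct_norm_finite[OF xy(2)]
    by (intro enn2real_mono) (metis ennreal_mult_less_top ennreal_less_top)+
  then show "oct_cross (tensor_of oct_space oct_space [(x, y)]) \<le> nrm oct_space x * nrm oct_space y"
    using oct_cross_le_rep_sum[of "[(x, y)]"] xy by (simp add: enn2real_mult)
next
  fix \<phi> \<psi> :: "(nat \<Rightarrow> 'k) \<Rightarrow> 'k" and u :: "('k, nat \<Rightarrow> 'k, nat \<Rightarrow> 'k) tensor"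
  assume "\<phi> \<in> dual oct_space" "\<psi> \<in> dual oct_space" "u \<in> oct_tensors"
  then show "norm (u (\<lambda>x y. \<phi> x * \<psi> y))
      \<le> dual_norm oct_space \<phi> * dual_norm oct_space \<psi> * oct_cross u"
    by (rule oct_cross_dual_le)
qed

section \<open>Failure of uniformity\<close>

text \<open>A multiple of the Hadamard matrix of size \<open>2\<close>, acting on the first two coordinates.\<close>

definition hadamard01 :: "(nat \<Rightarrow> 'k::real_normed_field) \<Rightarrow> nat \<Rightarrow> 'k" where
  "hadamard01 x = (\<lambda>i. if i = 0 then 2/3 * (x 0 + x 1) else if i = 1 then 2/3 * (x 0 - x 1) else 0)"

lemma norm_hadamard01:
  "norm (hadamard01 x 0) = 2/3 * norm (x 0 + x 1)"
  "norm (hadamard01 x 1) = 2/3 * norm (x 0 - x 1)"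
  by (simp_all only: hadamard01_def norm_two_thirds if_True if_False one_neq_zero refl)

lemma hadamard01_in_null_seqs: "hadamard01 x \<in> null_seqs"
  by (rule eventually_zero_in_null_seqs[of 2]) (simp add: hadamard01_def)

lemma norm_hadamard01_le:
  assumes "x \<in> null_seqs"
  shows "norm (hadamard01 x m) \<le> enn2real (oct_norm x)"
proof -
  have "2/3 * norm (x 0 + x 1) \<le> 2/3 * (norm (x 0) + norm (x 1))"
    using norm_triangle_ineq[of "x 0" "x 1"] by simp
  moreover have "2/3 * norm (x 0 - x 1) \<le> 2/3 * (norm (x 0) + norm (x 1))"
    using norm_triangle_ineq4[of "x 0" "x 1"] by simp
  moreover note nrm_oct_bounds(2)[OF assms]
  ultimately have "norm (hadamard01 x 0) \<le> enn2real (oct_norm x)"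
    "norm (hadamard01 x 1) \<le> enn2real (oct_norm x)"
    unfolding norm_hadamard01 by linarith+
  moreover have "hadamard01 x m = 0" if "m \<noteq> 0" "m \<noteq> 1"
    using that by (simp add: hadamard01_def)
  ultimately show ?thesis
    by (cases "m = 0"; cases "m = 1") auto
qed

lemma hadamard01_bounded: "hadamard01 \<in> bounded_ops oct_space oct_space"
proof -
  have "enn2real (oct_norm (hadamard01 x)) \<le> 4/3 * enn2real (oct_norm x)"
    if "x \<in> null_seqs" for x :: "nat \<Rightarrow> 'a"
    using nrm_oct_le_of_sup[OF hadamard01_in_null_seqs norm_hadamard01_le[OF that]] .
  moreover
  \<comment> \<open>Hiding the numeral keeps the simplifier from distributing it.\<close>
  define t where "t = (2/3 :: 'a)"
  have R: "hadamard01 x = (\<lambda>i. if i = 0 then t * (x 0 + x 1) else if i = 1 then t * (x 0 - x 1) else 0)"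
    for x
    unfolding hadamard01_def t_def ..
  have "hadamard01 (x + y) = hadamard01 x + hadamard01 y" for x y :: "nat \<Rightarrow> 'a"
    by (auto simp: R fun_eq_iff algebra_simps)
  moreover have "hadamard01 (fun_scl c x) = fun_scl c (hadamard01 x)" for c and x :: "nat \<Rightarrow> 'a"
    by (auto simp: R fun_scl_def fun_eq_iff algebra_simps)
  ultimately show ?thesis
    unfolding bounded_ops_def oct_space_simps using hadamard01_in_null_seqs by blast
qed

text \<open>
  On the given region \<open>|a|\<^sup>2 + |b|\<^sup>2 \<le> 5/4\<close>, so the left-hand side is at most \<open>\<surd>5\<close> by the
  parallelogram law, and \<open>\<surd>5 < 9/4\<close>.
\<close>

lemma norm_add_norm_diff_le:
  fixes a b :: "'a::real_inner"
  assumes "norm a \<le> 1" "norm b \<le> 1" "norm a + norm b \<le> 3/2"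
  shows "norm (a + b) + norm (a - b) \<le> 9/4"
proof -
  have sq: "(norm a)\<^sup>2 + (norm b)\<^sup>2 \<le> 5/4"
  proof -
    define s where "s = norm a + norm b"
    have s0: "0 \<le> s" "s \<le> 3/2" using assms by (auto simp: s_def)
    have ab: "0 \<le> norm a * norm b" by simp
    have "0 \<le> (1 - norm a) * (1 - norm b)" using assms by simp
    then have p: "s - 1 \<le> norm a * norm b" by (simp add: s_def algebra_simps)
    have e: "(norm a)\<^sup>2 + (norm b)\<^sup>2 = s\<^sup>2 - 2 * (norm a * norm b)"
      by (simp add: s_def power2_eq_square algebra_simps)
    show ?thesis
    proof (cases "s \<le> 1")
      case True
      then have "s\<^sup>2 \<le> 1" using s0 by (simp add: power_le_one)
      then show ?thesis using e ab by linarith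
    next
      case False
      have "0 \<le> (3/2 - s) * (s - 1/2)" using False s0 by simp
      moreover have "(3/2 - s) * (s - 1/2) = 2 * s - 3/4 - s\<^sup>2"
        by (simp add: power2_eq_square field_simps)
      ultimately have "s\<^sup>2 \<le> 2 * s - 3/4" by linarith
      then show ?thesis using e p by linarith
    qed
  qed
  have "(norm (a + b))\<^sup>2 + (norm (a - b))\<^sup>2 = 2 * (norm a)\<^sup>2 + 2 * (norm b)\<^sup>2"
    by (simp add: power2_norm_eq_inner inner_add inner_diff inner_commute)
  moreover have "0 \<le> (norm (a + b) - norm (a - b))\<^sup>2" by simp
  ultimately have "(norm (a + b) + norm (a - b))\<^sup>2 \<le> 5"
    using sq by (simp add: power2_eq_square algebra_simps)
  also have "\<dots> \<le> (9/4)\<^sup>2" by (simp add: power2_eq_square)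
  finally show ?thesis by (rule power2_le_imp_le) simp
qed

lemma op_norm_hadamard01_le:
  "op_norm oct_space oct_space
    (hadamard01 :: (nat \<Rightarrow> 'k::{real_normed_field, real_inner}) \<Rightarrow> _) \<le> 1"
proof (rule op_norm_le[OF normed_space_oct])
  fix x :: "nat \<Rightarrow> 'k" assume "x \<in> carr oct_space" "nrm oct_space x \<le> 1"
  then have x: "x \<in> null_seqs" and n: "enn2real (oct_norm x) \<le> 1" by auto
  have b: "\<And>m. norm (x m) \<le> 1" "2/3 * (norm (x 0) + norm (x 1)) \<le> 1"
    using nrm_oct_le_iff[OF x, of 1] n by auto
  have "norm (x 0 + x 1) + norm (x 0 - x 1) \<le> 9/4"
    using b by (intro norm_add_norm_diff_le) auto
  then have "2/3 * (norm (hadamard01 x 0) + norm (hadamard01 x 1)) \<le> 1"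
    unfolding norm_hadamard01 by (simp add: algebra_simps)
  moreover have "norm (hadamard01 x m) \<le> 1" for m
    using norm_hadamard01_le[OF x, of m] n by linarith
  ultimately show "nrm oct_space (hadamard01 x) \<le> 1"
    using nrm_oct_le_iff[OF hadamard01_in_null_seqs, of 1 x] by simp
qed

text \<open>A representation of \<open>e\<^sub>0 \<otimes> e\<^sub>0 + e\<^sub>1 \<otimes> e\<^sub>1\<close>.\<close>

definition diag01 :: "((nat \<Rightarrow> 'k::real_normed_field) \<times> (nat \<Rightarrow> 'k)) list" where
  "diag01 = [(unit_vec 0, unit_vec 0), (unit_vec 1, unit_vec 1)]"

lemma abs_pairing_unit_vec: "abs_pairing f (unit_vec m) = ennreal (norm (f (unit_vec m)))"
proof -
  have "abs_pairing f (unit_vec m) =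
      (\<Sum>i\<in>{m}. ennreal (norm (unit_vec m i * f (unit_vec i))))"
    unfolding abs_pairing_def by (rule suminf_finite) (auto simp: unit_vec_def)
  then show ?thesis by (simp add: unit_vec_def)
qed

text \<open>Both bounds come from pairing \<open>f\<close> with a vertex of the unit ball, \<open>(1, 1/2)\<close> or \<open>(1/2, 1)\<close>.\<close>

lemma dual_ball_oct_bounds:
  fixes f :: "(nat \<Rightarrow> 'k::real_normed_field) \<Rightarrow> 'k"
  assumes f: "f \<in> dual_ball oct_space"
  shows "norm (f (unit_vec 0)) + norm (f (unit_vec 1)) / 2 \<le> 1"
    and "norm (f (unit_vec 0)) / 2 + norm (f (unit_vec 1)) \<le> 1"
proof -
  have test: "a * norm (f (unit_vec 0)) + b * norm (f (unit_vec 1)) \<le> 1"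
    if ab: "0 \<le> a" "a \<le> 1" "0 \<le> b" "b \<le> 1" "a + b \<le> 3/2" for a b :: real
  proof -
    define x :: "nat \<Rightarrow> 'k" where "x = (\<lambda>i. if i = 0 then of_real a else if i = 1 then of_real b else 0)"
    have "oct_norm x \<le> ennreal 1"
      using ab by (subst oct_norm_le_iff) (auto simp: x_def)
    moreover have "ennreal (\<Sum>m\<in>{0, 1}. norm (x m * f (unit_vec m))) \<le> abs_pairing f x"
      by (rule finite_sum_le_abs_pairing) simp
    ultimately have "ennreal (\<Sum>m\<in>{0, 1}. norm (x m * f (unit_vec m))) \<le> ennreal 1"
      using abs_pairing_le[OF f, of x] by (meson order_trans)
    then have "(\<Sum>m\<in>{0, 1}. norm (x m * f (unit_vec m))) \<le> 1"
      by (subst (asm) ennreal_le_iff) auto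
    then show ?thesis using ab by (simp add: x_def norm_mult)
  qed
  from test[of 1 "1/2"] test[of "1/2" 1]
  show "norm (f (unit_vec 0)) + norm (f (unit_vec 1)) / 2 \<le> 1"
    and "norm (f (unit_vec 0)) / 2 + norm (f (unit_vec 1)) \<le> 1" by simp_all
qed

text \<open>
  The points \<open>(p, q)\<close> and \<open>(r, s)\<close> lie in the positive quadrant of the dual octagon, with vertices
  \<open>(1, 0)\<close>, \<open>(2/3, 2/3)\<close> and \<open>(0, 1)\<close>. For fixed \<open>(p, q)\<close> the claim is a linear programme in
  \<open>(r, s)\<close>, and the coefficients used in the three cases are solutions of the dual programme.
\<close>

lemma dual_octagon_pairing_le_one:
  fixes p q r s :: real
  assumes "0 \<le> p" "0 \<le> q" "p + q / 2 \<le> 1" "p / 2 + q \<le> 1"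
    and "0 \<le> r" "0 \<le> s" "r + s / 2 \<le> 1" "r / 2 + s \<le> 1"
  shows "p * r + q * s \<le> 1"
proof -
  consider "q \<ge> 2 * p" | "p \<ge> 2 * q" | "q \<le> 2 * p" "p \<le> 2 * q" by linarith
  then show ?thesis
  proof cases
    case 1
    have "p * r \<le> q / 2 * r" using 1 assms by (intro mult_right_mono) auto
    moreover have "q * (r / 2 + s) \<le> 1 * 1" using assms by (intro mult_mono) auto
    ultimately show ?thesis by (simp add: algebra_simps)
  next
    case 2
    have "q * s \<le> p / 2 * s" using 2 assms by (intro mult_right_mono) auto
    moreover have "p * (r + s / 2) \<le> 1 * 1" using assms by (intro mult_mono) auto
    ultimately show ?thesis by (simp add: algebra_simps)
  next
    case 3
    have "(4 * p - 2 * q) / 3 * (r + s / 2) \<le> (4 * p - 2 * q) / 3 * 1"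
      using 3 assms by (intro mult_left_mono) auto
    moreover have "(4 * q - 2 * p) / 3 * (r / 2 + s) \<le> (4 * q - 2 * p) / 3 * 1"
      using 3 assms by (intro mult_left_mono) auto
    moreover have "p * r + q * s =
        (4 * p - 2 * q) / 3 * (r + s / 2) + (4 * q - 2 * p) / 3 * (r / 2 + s)"
      by (simp add: field_simps)
    moreover have "(4 * p - 2 * q) / 3 + (4 * q - 2 * p) / 3 \<le> 1"
      using assms by (simp add: field_simps)
    ultimately show ?thesis by linarith
  qed
qed

lemma rep_sum_diag01_le: "rep_sum diag01 \<le> 1"
proof -
  have "bess_sum oct_space unit_basis oct_space unit_basis
      (diag01 :: ((nat \<Rightarrow> 'a) \<times> (nat \<Rightarrow> 'a)) list) \<le> ennreal 1"
  proof (rule bess_sum_le)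
    fix f g :: "(nat \<Rightarrow> 'a) \<Rightarrow> 'a"
    assume f: "f \<in> dual_ball oct_space" and g: "g \<in> dual_ball oct_space"
    have "norm (f (unit_vec 0)) * norm (g (unit_vec 0)) +
        norm (f (unit_vec 1)) * norm (g (unit_vec 1)) \<le> 1"
      using dual_ball_oct_bounds[OF f] dual_ball_oct_bounds[OF g]
      by (intro dual_octagon_pairing_le_one) auto
    then have "ennreal (norm (f (unit_vec 0)) * norm (g (unit_vec 0)) +
        norm (f (unit_vec 1)) * norm (g (unit_vec 1))) \<le> ennreal 1"
      by (rule ennreal_leI)
    then show "(\<Sum>(x, y)\<leftarrow>diag01. abs_pairing f x * abs_pairing g y) \<le> ennreal 1"
      by (simp add: diag01_def abs_pairing_unit_vec ennreal_mult)
  qed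
  then have "rep_sum (diag01 :: ((nat \<Rightarrow> 'a) \<times> (nat \<Rightarrow> 'a)) list) \<le> enn2real (ennreal 1)"
    by (intro enn2real_mono) auto
  then show ?thesis by simp
qed

lemma entries_le_rep_sum:
  assumes zs: "set zs \<subseteq> null_seqs \<times> null_seqs"
  shows "4/9 * (\<Sum>m<2. \<Sum>n<2. norm (\<Sum>(x, y)\<leftarrow>zs. x m * y n)) \<le> rep_sum zs"
proof -
  let ?t = "\<lambda>x y. (2/3 * (norm (x 0) + norm (x 1))) * (2/3 * (norm (y 0) + norm (y 1)))"
  have two: "{..<2::nat} = {0, 1}" by auto
  have "ennreal (\<Sum>(x, y)\<leftarrow>zs. ?t x y) \<le>
      (\<Sum>(x, y)\<leftarrow>zs. abs_pairing oct_functional x * abs_pairing oct_functional y)"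
  proof (induction zs)
    case (Cons z zs)
    obtain x y where z: "z = (x, y)" by force
    have "0 \<le> (\<Sum>(x, y)\<leftarrow>zs. ?t x y)"
      by (rule sum_list_nonneg) auto
    then have "ennreal (\<Sum>(x, y)\<leftarrow>z # zs. ?t x y) = ennreal (?t x y) + ennreal (\<Sum>(x, y)\<leftarrow>zs. ?t x y)"
      unfolding z by (simp del: One_nat_def)
    also have "ennreal (?t x y) \<le> abs_pairing oct_functional x * abs_pairing oct_functional y"
      using mult_mono[OF le_abs_pairing_oct_functional[of x] le_abs_pairing_oct_functional[of y]]
      by (subst ennreal_mult) auto
    also have "abs_pairing oct_functional x * abs_pairing oct_functional y +
        ennreal (\<Sum>(x, y)\<leftarrow>zs. ?t x y) \<le>
        abs_pairing oct_functional x * abs_pairing oct_functional y +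
        (\<Sum>(x, y)\<leftarrow>zs. abs_pairing oct_functional x * abs_pairing oct_functional y)"
      by (intro add_mono order_refl Cons)
    finally show ?case unfolding z by (simp only: list.map sum_list.Cons prod.case add_mono)
  qed simp
  also have "\<dots> \<le> ennreal (rep_sum zs)"
    using pairing_sum_le_bess_sum[OF oct_functional_in_dual_ball oct_functional_in_dual_ball]
      bess_sum_finite[OF zs] by metis
  finally have 1: "(\<Sum>(x, y)\<leftarrow>zs. ?t x y) \<le> rep_sum zs" by simp
  have "4/9 * (\<Sum>m<2. \<Sum>n<2. norm (\<Sum>(x, y)\<leftarrow>zs. x m * y n)) \<le> (\<Sum>(x, y)\<leftarrow>zs. ?t x y)"
  proof (induction zs)
    case (Cons z zs)
    obtain x y where z: "z = (x, y)" by force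
    let ?s = "\<lambda>m n. \<Sum>(x, y)\<leftarrow>zs. x m * y n"
    have "(\<Sum>m<2. \<Sum>n<2. norm (x m * y n + ?s m n)) \<le>
        (\<Sum>m<2. \<Sum>n<2. norm (x m * y n) + norm (?s m n))"
      by (intro sum_mono norm_triangle_ineq)
    also have "\<dots> = (\<Sum>m<2. \<Sum>n<2. norm (x m * y n)) + (\<Sum>m<2. \<Sum>n<2. norm (?s m n))"
      by (simp add: sum.distrib)
    also have "(\<Sum>m<2. \<Sum>n<2. norm (x m * y n)) = 9/4 * ?t x y"
      by (simp add: two norm_mult algebra_simps)
    finally show ?case using Cons z by simp
  qed simp
  with 1 show ?thesis by linarith
qed

lemma entries_le_oct_cross:
  assumes u: "u \<in> oct_tensors"
  shows "4/9 * (\<Sum>m<2. \<Sum>n<2. norm (u (\<lambda>x y. x m * y n))) \<le> oct_cross u"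
proof -
  have "4/9 * (\<Sum>m<2. \<Sum>n<2. norm (u (\<lambda>x y. x m * y n))) \<le> 1 * oct_cross u"
  proof (rule le_oct_crossI[OF u])
    fix zs :: "((nat \<Rightarrow> 'a) \<times> (nat \<Rightarrow> 'a)) list"
    assume zs: "set zs \<subseteq> null_seqs \<times> null_seqs" "tensor_of oct_space oct_space zs = u"
    have "u (\<lambda>x y. x m * y n) = (\<Sum>(x, y)\<leftarrow>zs. x m * y n)" for m n
      by (simp add: zs(2)[symmetric] tensor_of_def entry_form_bilinear)
    then show "4/9 * (\<Sum>m<2. \<Sum>n<2. norm (u (\<lambda>x y. x m * y n))) \<le> 1 * rep_sum zs"
      using entries_le_rep_sum[OF zs(1)] by simp
  qed simp
  then show ?thesis by simp
qed

lemma not_uniform_crossnorm_oct: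
  "\<not> uniform_crossnorm
    (oct_space :: ('k::{real_normed_field, real_inner}, nat \<Rightarrow> 'k) nspace) oct_space oct_cross"
proof
  let ?E = "oct_space :: ('k, nat \<Rightarrow> 'k) nspace"
  let ?S = "hadamard01 :: (nat \<Rightarrow> 'k) \<Rightarrow> _"
  assume unif: "uniform_crossnorm ?E ?E oct_cross"
  have id: "id \<in> bounded_ops ?E ?E"
    by (auto simp: bounded_ops_def intro: exI[of _ 1])
  have id1: "op_norm ?E ?E id \<le> 1"
    by (rule op_norm_le[OF normed_space_oct]) simp
  have d: "set (diag01 :: ((nat \<Rightarrow> 'k) \<times> (nat \<Rightarrow> 'k)) list) \<subseteq> null_seqs \<times> null_seqs"
    by (simp add: diag01_def unit_vec_in_null_seqs)
  define u where "u = tensor_of ?E ?E diag01"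
  define v where "v = tensor_map ?E ?E ?S id u"
  have u: "u \<in> oct_tensors"
    unfolding u_def by (rule oct_tensors_intros(1)[OF d])
  have v: "v = tensor_of ?E ?E [(?S (unit_vec 0), unit_vec 0), (?S (unit_vec 1), unit_vec 1)]"
    unfolding v_def u_def tensor_map_tensor_of[OF hadamard01_bounded id] by (simp add: diag01_def)
  have "v \<in> oct_tensors"
    unfolding v by (intro oct_tensors_intros(1)) (simp add: unit_vec_in_null_seqs hadamard01_in_null_seqs)
  then have "4/9 * (\<Sum>m<2. \<Sum>n<2. norm (v (\<lambda>x y. x m * y n))) \<le> oct_cross v"
    by (rule entries_le_oct_cross)
  moreover have "norm (v (\<lambda>x y. x m * y n)) = 2/3" if "m < 2" "n < 2" for m n
  proof -
    have "v (\<lambda>x y. x m * y n) = ?S (unit_vec 0) m * unit_vec 0 n + ?S (unit_vec 1) m * unit_vec 1 n"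
      by (simp add: v tensor_of_def entry_form_bilinear)
    moreover have "m = 0 \<or> m = 1" "n = 0 \<or> n = 1" using that by auto
    ultimately show ?thesis
      by (auto simp: hadamard01_def unit_vec_def norm_divide)
  qed
  ultimately have low: "32/27 \<le> oct_cross v" by simp
  have "oct_cross v \<le> op_norm ?E ?E ?S * op_norm ?E ?E id * oct_cross u"
    using unif hadamard01_bounded id u by (auto simp: uniform_crossnorm_def v_def)
  also have "\<dots> \<le> 1 * 1 * 1"
  proof (intro mult_mono op_norm_hadamard01_le id1)
    show "oct_cross u \<le> 1"
      using oct_cross_le_rep_sum[OF d] rep_sum_diag01_le u_def by (metis order_trans)
    show "0 \<le> op_norm ?E ?E id"
      by (rule op_norm_nonneg[OF normed_space_oct normed_space_oct id])
    show "0 \<le> oct_cross u" by (rule oct_cross_nonneg)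
  qed auto
  finally show False using low by simp
qed

lemma oct_space_counterexample:
  "\<exists>(E :: ('k::{real_normed_field, real_inner, banach}, nat \<Rightarrow> 'k) nspace)
      (F :: ('k, nat \<Rightarrow> 'k) nspace) \<F> \<G>.
      banach_space E \<and> banach_space F \<and> usb E \<F> \<and> usb F \<G> \<and>
      reasonable_crossnorm (bess_space E \<F>) (bess_space F \<G>) (bess_crossnorm E \<F> F \<G>) \<and>
      \<not> uniform_crossnorm (bess_space E \<F>) (bess_space F \<G>) (bess_crossnorm E \<F> F \<G>)"
  by (intro exI[of _ oct_space] exI[of _ unit_basis])
    (simp add: bess_space_oct banach_space_oct usb_unit_basis reasonable_crossnorm_oct
      not_uniform_crossnorm_oct)

theorem mainTheorem5:
  "(\<exists>(E :: (real, nat \<Rightarrow> real) nspace) (F :: (real, nat \<Rightarrow> real) nspace) \<F> \<G>.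
      banach_space E \<and> banach_space F \<and> usb E \<F> \<and> usb F \<G> \<and>
      reasonable_crossnorm (bess_space E \<F>) (bess_space F \<G>) (bess_crossnorm E \<F> F \<G>) \<and>
      \<not> uniform_crossnorm (bess_space E \<F>) (bess_space F \<G>) (bess_crossnorm E \<F> F \<G>)) \<and>
   (\<exists>(E :: (complex, nat \<Rightarrow> complex) nspace) (F :: (complex, nat \<Rightarrow> complex) nspace) \<F> \<G>.
      banach_space E \<and> banach_space F \<and> usb E \<F> \<and> usb F \<G> \<and>
      reasonable_crossnorm (bess_space E \<F>) (bess_space F \<G>) (bess_crossnorm E \<F> F \<G>) \<and>
      \<not> uniform_crossnorm (bess_space E \<F>) (bess_space F \<G>) (bess_crossnorm E \<F> F \<G>))"
  by (intro conjI oct_space_counterexample)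

end
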